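(* For all $n\ge1$, $$\sum_{\sigma\in\mathfrak S_n}q^{\mathrm{aid}(\sigma)}t^{\mathrm{des}(\sigma)}=\sum_{\sigma\in\mathfrak S_n}q^{\mathrm{maj}(\sigma)}t^{\mathrm{exc}(\sigma)},$$ where $\mathrm{aid}(\sigma)=\mathrm{ai}(\sigma)+\mathrm{des}(\sigma)$ and $\mathrm{ai}(\sigma)$ is the number of admissible inversions of $\sigma$.
   Context: $\mathfrak S_n$ is the set of permutations of $[n]=\{1,\dots,n\}$. For $\sigma\in\mathfrak S_n$: $\mathrm{DES}(\sigma)=\{i\in[n-1]:\sigma(i)>\sigma(i+1)\}$, $\mathrm{des}(\sigma)=|\mathrm{DES}(\sigma)|$, $\mathrm{maj}(\sigma)=\sum_{i\in\mathrm{DES}(\sigma)}i$, $\mathrm{exc}(\sigma)=|\{i\in[n-1]:\sigma(i)>i\}|$. An admissible inversion of $\sigma\in\mathfrak S_n$ is a pair $(\sigma(i),\sigma(j))$ with $1\le i<j\le n$ and $\sigma(i)>\sigma(j)$ such that either $j<n$ and $\sigma(j)<\sigma(j+1)$, or there exists $k$ with $i<k<j$ and $\sigma(k)<\sigma(j)$. For example, the admissible inversions of $24153$ are $(2,1),(4,1),(4,3)$, so $\mathrm{aid}(24153)=3+2=5$. *)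

theory Defs
  imports "HOL-Combinatorics.Permutations"
begin

text \<open>
  Permutations of \<open>{1..n}\<close> are functions \<open>\<sigma>\<close> with \<open>\<sigma> permutes {1..n}\<close>; since
  the type does not record \<open>n\<close>, every statistic takes it as an argument.
\<close>

definition DES :: "nat \<Rightarrow> (nat \<Rightarrow> nat) \<Rightarrow> nat set" where
  "DES n \<sigma> = {i \<in> {1..n - 1}. \<sigma> i > \<sigma> (i + 1)}"

definition des :: "nat \<Rightarrow> (nat \<Rightarrow> nat) \<Rightarrow> nat" where
  "des n \<sigma> = card (DES n \<sigma>)"

definition maj :: "nat \<Rightarrow> (nat \<Rightarrow> nat) \<Rightarrow> nat" where
  "maj n \<sigma> = \<Sum> (DES n \<sigma>)"

definition exc :: "nat \<Rightarrow> (nat \<Rightarrow> nat) \<Rightarrow> nat" where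
  "exc n \<sigma> = card {i \<in> {1..n - 1}. \<sigma> i > i}"

definition admissible_inversions :: "nat \<Rightarrow> (nat \<Rightarrow> nat) \<Rightarrow> (nat \<times> nat) set" where
  "admissible_inversions n \<sigma> =
     {(\<sigma> i, \<sigma> j) | i j. 1 \<le> i \<and> i < j \<and> j \<le> n \<and> \<sigma> i > \<sigma> j \<and>
        ((j < n \<and> \<sigma> j < \<sigma> (j + 1)) \<or> (\<exists>k. i < k \<and> k < j \<and> \<sigma> k < \<sigma> j))}"

definition ai :: "nat \<Rightarrow> (nat \<Rightarrow> nat) \<Rightarrow> nat" where
  "ai n \<sigma> = card (admissible_inversions n \<sigma>)"

definition aid :: "nat \<Rightarrow> (nat \<Rightarrow> nat) \<Rightarrow> nat" where
  "aid n \<sigma> = ai n \<sigma> + des n \<sigma>"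

end

theory Submission
  imports Defs
    "HOL-Combinatorics.Multiset_Permutations"
    "HOL-Computational_Algebra.Formal_Power_Series"
    "HOL-Computational_Algebra.Polynomial"
    "HOL-Library.Infinite_Set"
begin

text \<open>
  Both sides satisfy the same quadratic recurrence. Splitting a permutation word at its least
  letter as \<open>L 1 R\<close> gives one for \<open>(ai, des)\<close>. For \<open>(maj, exc)\<close>, mark the excedance letters of
  \<open>\<sigma>\<close> and let \<open>dex\<close> be the descent set of the marked word, marked letters being smaller than unmarked
  ones; then \<open>maj \<sigma> = \<Sum> dex \<sigma> + exc \<sigma>\<close>. By MacMahon's argument the distribution of \<open>(\<Sum> dex, exc)\<close>,
  divided by \<open>(1 - q) \<dots> (1 - q^n)\<close>, counts pairs of \<open>\<sigma>\<close> and a weakly decreasing filling that drops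
  at \<open>dex \<sigma>\<close>. Following Eulerian walks through the biword of such a pair (Foata's first fundamental
  transformation, with marks) turns these pairs into the banners of Shareshian and Wachs with the same
  letters, and banners split at their last zero satisfy the recurrence.
\<close>


section \<open>Banners and predecessor lists\<close>

text \<open>Both sides shift their first statistic by the second: \<open>aid\<close> is
  \<open>ai + des\<close> and \<open>maj\<close> is \<open>\<Sum> dex + exc\<close>. So it suffices
  that \<open>(ai, des)\<close> and \<open>(\<Sum> dex, exc)\<close> have the same joint
  distribution. The division by \<open>qfact n\<close> is there because the letters to the left of
  the least letter are chosen with q-binomial weight; dividing absorbs this weight and leaves a
  plain convolution, which is what cutting a banner gives. The obstacle is repeated letters. A
  permutation with a filling \<open>g\<close> becomes a multigraph of letters, with an edge from
  \<open>g i\<close> to \<open>g (\<sigma> i)\<close> and an order on the edges into each letter.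
  The weak inequalities of \<open>trans_ok\<close> do not force \<open>i < \<sigma> i\<close> inside
  a block of equal barred letters; the condition on \<open>hd\<close> in \<open>pred_lists\<close>
  supplies the missing strictness. Multigraphs and banners are matched by counting: both numbers
  obey one recursion on the last edge. In the series, q is \<open>fps_X\<close> and \<open>t\<close>
  lies in a commutative ring. Taking \<open>t\<close> as the variable of integer polynomials yields
  the joint counts, and these serve every commutative semiring.\<close>

text \<open>
  A letter \<open>c\<close> stands for the value \<open>c div 2\<close>, barred iff \<open>c\<close> is odd. With this coding a barred letter
  may be followed by any value at most its own and an unbarred one by any value at least its own.
\<close>

definition trans_ok :: "nat \<Rightarrow> nat \<Rightarrow> bool" where
  "trans_ok a b \<longleftrightarrow> (if odd a then b \<le> a else a \<le> b)"

definition banner :: "nat list \<Rightarrow> bool" where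
  "banner w \<longleftrightarrow> successively trans_ok w \<and> (w \<noteq> [] \<longrightarrow> even (last w))"

text \<open>The letter \<open>c\<close> is the current endpoint of a walk that is being traced
  backwards; \<open>l\<close> holds only the letters still to be visited.\<close>

definition words_to :: "nat \<Rightarrow> nat multiset \<Rightarrow> nat list set" where
  "words_to c l = {w. mset w = l \<and> successively trans_ok (w @ [c])}"

text \<open>
  The list \<open>u b\<close> records the predecessors of the occurrences of \<open>b\<close> in a multigraph of letters;
  \<open>k\<close> counts the incoming and \<open>l\<close> the outgoing edges.
\<close>

definition pred_lists ::
  "nat set \<Rightarrow> nat multiset \<Rightarrow> nat multiset \<Rightarrow> (nat \<Rightarrow> nat list) set" where
  "pred_lists E k l = {u. (\<forall>b. length (u b) = count k b) \<and>
     (\<Sum>b\<in>set_mset k. mset (u b)) = l \<and>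
     (\<forall>b. \<forall>a\<in>set (u b). trans_ok a b) \<and>
     (\<forall>b\<in>E. u b \<noteq> [] \<longrightarrow> hd (u b) \<noteq> b)}"

lemma finite_mset_eq: "finite {w. mset w = l \<and> P w}"
  by (rule finite_subset[OF _ finite_permutations_of_multiset[of l]])
     (auto simp: permutations_of_multiset_def)

lemma finite_pred_lists: "finite (pred_lists E k l)"
proof -
  let ?B = "{xs. set xs \<subseteq> set_mset l \<and> length xs \<le> size k}"
  have "pred_lists E k l \<subseteq> {u. \<forall>b. (b \<in> set_mset k \<longrightarrow> u b \<in> ?B) \<and> (b \<notin> set_mset k \<longrightarrow> u b = [])}"
  proof
    fix u assume "u \<in> pred_lists E k l"
    then have len: "\<forall>b. length (u b) = count k b" and s: "(\<Sum>b\<in>set_mset k. mset (u b)) = l"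
      by (auto simp: pred_lists_def)
    have "u b \<in> ?B" if "b \<in># k" for b
    proof -
      have "mset (u b) \<subseteq># l" using that by (simp add: sum.remove flip: s)
      then show ?thesis using len by (auto simp: count_le_size dest: mset_subset_eqD)
    qed
    moreover have "u b = []" if "b \<notin># k" for b
      using len that by (metis count_eq_zero_iff length_0_conv)
    ultimately show "u \<in> {u. \<forall>b. (b \<in> set_mset k \<longrightarrow> u b \<in> ?B) \<and> (b \<notin> set_mset k \<longrightarrow> u b = [])}"
      by blast
  qed
  moreover have "finite \<dots>"
    by (rule finite_set_of_finite_funs) (auto simp: finite_lists_length_le)
  ultimately show ?thesis by (rule finite_subset)
qed

lemma sum_mset_update:
  assumes "finite A" "c \<in> A"
  shows "(\<Sum>b\<in>A. mset ((u(c := u c @ [a])) b)) = (\<Sum>b\<in>A. mset (u b)) + {#a#}"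
  using assms by (simp add: sum.remove[of _ c])

text \<open>Removing an occurrence of \<open>c\<close> may take \<open>c\<close> out of the support;
  it can stay an index of the sum because its list is then empty.\<close>

lemma sum_mset_extend:
  assumes "\<forall>b. length (u b) = count k b"
  shows "(\<Sum>b\<in>set_mset k. mset (u b)) = (\<Sum>b\<in>insert c (set_mset k). mset (u b))"
  using assms by (intro sum.mono_neutral_left) (auto simp: count_eq_zero_iff[symmetric] simp flip: length_0_conv simp del: length_0_conv count_eq_zero_iff)

text \<open>The last edge into \<open>c\<close> is removed or restored. Restoring it can violate the
  condition on heads only when the list of \<open>c\<close> was empty, for then the new entry is
  also the head; the second hypothesis keeps that entry different from \<open>c\<close>. The set
  \<open>A\<close> serves the start of a new walk, where the last entry is constrained.\<close>

lemma pred_lists_snoc: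
  assumes c: "c \<in># k" and E: "c \<in> E \<and> count k c = 1 \<longrightarrow> c \<notin># l"
  shows "{u \<in> pred_lists E k l. last (u c) \<in> A} =
    (\<Union>a\<in>{a \<in> set_mset l. trans_ok a c \<and> a \<in> A}.
      (\<lambda>u. u(c := u c @ [a])) ` pred_lists E (k - {#c#}) (l - {#a#}))"
    (is "?L = ?R")
proof (intro equalityI subsetI)
  fix u assume u: "u \<in> ?L"
  define a where "a = last (u c)"
  define v where "v = u(c := butlast (u c))"
  have len: "\<forall>b. length (u b) = count k b" and s: "(\<Sum>b\<in>set_mset k. mset (u b)) = l"
    and tr: "\<forall>b. \<forall>a\<in>set (u b). trans_ok a b" and hd: "\<forall>b\<in>E. u b \<noteq> [] \<longrightarrow> hd (u b) \<noteq> b"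
    and aA: "a \<in> A"
    using u by (auto simp: pred_lists_def a_def)
  have "u c \<noteq> []" using len c by (metis count_greater_zero_iff length_greater_0_conv)
  then have uv: "u = v(c := v c @ [a])" by (auto simp: v_def a_def)
  have lenv: "\<forall>b. length (v b) = count (k - {#c#}) b"
    using len by (auto simp: v_def)
  have "l = (\<Sum>b\<in>set_mset k. mset ((v(c := v c @ [a])) b))" using s uv by simp
  also have "\<dots> = (\<Sum>b\<in>set_mset k. mset (v b)) + {#a#}"
    by (rule sum_mset_update) (use c in auto)
  also have "set_mset k = insert c (set_mset (k - {#c#}))"
    using c by (auto dest: in_diffD) (metis insert_DiffM insert_noteq_member)
  also have "(\<Sum>b\<in>insert c (set_mset (k - {#c#})). mset (v b)) = (\<Sum>b\<in>set_mset (k - {#c#}). mset (v b))"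
    by (rule sum_mset_extend[OF lenv, symmetric])
  finally have l: "l = (\<Sum>b\<in>set_mset (k - {#c#}). mset (v b)) + {#a#}" .
  have "v \<in> pred_lists E (k - {#c#}) (l - {#a#})"
    unfolding pred_lists_def
  proof (intro CollectI conjI)
    show "\<forall>b. \<forall>a\<in>set (v b). trans_ok a b" using tr by (auto simp: v_def dest: in_set_butlastD)
    show "\<forall>b\<in>E. v b \<noteq> [] \<longrightarrow> hd (v b) \<noteq> b"
      using hd by (auto simp: v_def) (metis append_butlast_last_id butlast.simps(1) hd_append)
  qed (use lenv l in auto)
  moreover have "trans_ok a c" using tr \<open>u c \<noteq> []\<close> by (auto simp: a_def)
  moreover have "a \<in># l" using l by simp
  ultimately show "u \<in> ?R" using uv aA by blast
next
  fix u assume "u \<in> ?R"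
  then obtain a v where a: "a \<in># l" "trans_ok a c" "a \<in> A" and uv: "u = v(c := v c @ [a])"
    and v: "v \<in> pred_lists E (k - {#c#}) (l - {#a#})" by blast
  have len: "\<forall>b. length (v b) = count (k - {#c#}) b"
    and s: "(\<Sum>b\<in>set_mset (k - {#c#}). mset (v b)) = l - {#a#}"
    and tr: "\<forall>b. \<forall>a\<in>set (v b). trans_ok a b" and hd: "\<forall>b\<in>E. v b \<noteq> [] \<longrightarrow> hd (v b) \<noteq> b"
    using v by (auto simp: pred_lists_def)
  have pos: "count k c > 0" using c by simp
  have k: "set_mset k = insert c (set_mset (k - {#c#}))"
    using c by (auto dest: in_diffD) (metis insert_DiffM insert_noteq_member)
  have "(\<Sum>b\<in>set_mset k. mset (u b)) = (\<Sum>b\<in>set_mset k. mset (v b)) + {#a#}"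
    unfolding uv by (rule sum_mset_update) (use c in auto)
  also have "(\<Sum>b\<in>set_mset k. mset (v b)) = l - {#a#}"
    using sum_mset_extend[OF len, of c] s k by simp
  also have "l - {#a#} + {#a#} = l" using a by simp
  finally have l: "(\<Sum>b\<in>set_mset k. mset (u b)) = l" .
  have "u \<in> pred_lists E k l"
    unfolding pred_lists_def
  proof (intro CollectI conjI)
    show "\<forall>b. length (u b) = count k b" using len pos by (auto simp: uv)
    show "\<forall>b. \<forall>a\<in>set (u b). trans_ok a b" using tr a by (auto simp: uv)
    show "\<forall>b\<in>E. u b \<noteq> [] \<longrightarrow> hd (u b) \<noteq> b"
    proof (intro ballI impI)
      fix b assume b: "b \<in> E" "u b \<noteq> []"
      show "hd (u b) \<noteq> b"
      proof (cases "b = c \<and> v c = []")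
        case True
        then have "count k c = 1" using len[rule_format, of c] pos by (simp add: le_Suc_eq)
        then show ?thesis using E True b a by (auto simp: uv)
      next
        case False
        then show ?thesis using b hd by (auto simp: uv)
      qed
    qed
  qed (rule l)
  then show "u \<in> ?L" using a by (simp add: uv)
qed

lemma card_pred_lists_snoc:
  assumes "c \<in># k" "c \<in> E \<and> count k c = 1 \<longrightarrow> c \<notin># l"
  shows "card {u \<in> pred_lists E k l. last (u c) \<in> A} =
    (\<Sum>a | a \<in># l \<and> trans_ok a c \<and> a \<in> A. card (pred_lists E (k - {#c#}) (l - {#a#})))"
proof -
  have inj: "inj_on (\<lambda>u. u(c := u c @ [a])) S" for a and S :: "(nat \<Rightarrow> nat list) set"
  proof (rule inj_onI)
    fix u v :: "nat \<Rightarrow> nat list" assume "u(c := u c @ [a]) = v(c := v c @ [a])"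
    then have "\<And>b. (u(c := u c @ [a])) b = (v(c := v c @ [a])) b" by simp
    then have "u b = v b" for b by (metis append1_eq_conv fun_upd_apply)
    then show "u = v" by auto
  qed
  have "card {u \<in> pred_lists E k l. last (u c) \<in> A} =
    (\<Sum>a | a \<in># l \<and> trans_ok a c \<and> a \<in> A.
      card ((\<lambda>u. u(c := u c @ [a])) ` pred_lists E (k - {#c#}) (l - {#a#})))"
    unfolding pred_lists_snoc[OF assms]
  proof (subst card_UN_disjoint)
    have "a = a'" if "u(c := u c @ [a]) = v(c := v c @ [a'])" for a a' and u v :: "nat \<Rightarrow> nat list"
      using fun_cong[OF that, of c] by simp
    then show "\<forall>i\<in>{a \<in> set_mset l. trans_ok a c \<and> a \<in> A}. \<forall>j\<in>{a \<in> set_mset l. trans_ok a c \<and> a \<in> A}. i \<noteq> j \<longrightarrow>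
      (\<lambda>u. u(c := u c @ [i])) ` pred_lists E (k - {#c#}) (l - {#i#}) \<inter>
      (\<lambda>u. u(c := u c @ [j])) ` pred_lists E (k - {#c#}) (l - {#j#}) = {}" by blast
  qed (auto simp: finite_pred_lists)
  also have "\<dots> = (\<Sum>a | a \<in># l \<and> trans_ok a c \<and> a \<in> A. card (pred_lists E (k - {#c#}) (l - {#a#})))"
    by (simp add: card_image inj)
  finally show ?thesis .
qed

lemma card_words_snoc:
  assumes "l \<noteq> {#}"
  shows "card {w. mset w = l \<and> successively trans_ok w \<and> last w \<in> A} =
    (\<Sum>a | a \<in># l \<and> a \<in> A. card (words_to a (l - {#a#})))"
proof -
  have "{w. mset w = l \<and> successively trans_ok w \<and> last w \<in> A} =
    (\<Union>a\<in>{a \<in> set_mset l. a \<in> A}. (\<lambda>w. w @ [a]) ` words_to a (l - {#a#}))" (is "?L = ?R")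
  proof (intro equalityI subsetI)
    fix w assume w: "w \<in> ?L"
    then have "w \<noteq> []" using assms by auto
    then obtain v a where "w = v @ [a]" by (metis rev_exhaust)
    then show "w \<in> ?R" using w by (auto simp: words_to_def)
  qed (auto simp: words_to_def)
  moreover have "card \<dots> = (\<Sum>a | a \<in># l \<and> a \<in> A. card ((\<lambda>w. w @ [a]) ` words_to a (l - {#a#})))"
    by (subst card_UN_disjoint) (auto simp: words_to_def finite_mset_eq)
  moreover have "\<dots> = (\<Sum>a | a \<in># l \<and> a \<in> A. card (words_to a (l - {#a#})))"
    by (simp add: card_image inj_on_def)
  ultimately show ?thesis by simp
qed

lemma card_words_to:
  assumes "l \<noteq> {#}"
  shows "card (words_to c l) = (\<Sum>a | a \<in># l \<and> trans_ok a c. card (words_to a (l - {#a#})))"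
proof -
  have "words_to c l = {w. mset w = l \<and> successively trans_ok w \<and> last w \<in> {a. trans_ok a c}}"
    using assms by (auto simp: words_to_def successively_append_iff)
  then show ?thesis using card_words_snoc[OF assms, of "{a. trans_ok a c}"] by simp
qed

lemma pred_lists_rev:
  assumes "c \<notin> E"
  shows "bij_betw (\<lambda>u. u(c := rev (u c))) (pred_lists (insert c E) k l)
    {u \<in> pred_lists E k l. u c \<noteq> [] \<longrightarrow> last (u c) \<noteq> c}"
proof -
  define r where "r u = u(c := rev (u c))" for u :: "nat \<Rightarrow> nat list"
  have r: "length (r u b) = length (u b)" "mset (r u b) = mset (u b)" "set (r u b) = set (u b)"
    "r (r u) = u" "b \<noteq> c \<Longrightarrow> r u b = u b" "r u c = rev (u c)" for u b
    by (auto simp: r_def)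
  have "r u b = u b" if "b \<in> E" for u b using assms that by (auto simp: r_def)
  with r have "bij_betw r (pred_lists (insert c E) k l)
    {u \<in> pred_lists E k l. u c \<noteq> [] \<longrightarrow> last (u c) \<noteq> c}"
    by (intro bij_betwI[where g = r]) (auto simp: pred_lists_def hd_rev last_rev)
  then show ?thesis unfolding r_def .
qed

text \<open>
  Removing the last entry of \<open>u c\<close> is a step backwards along a walk from \<open>M\<close> to \<open>c\<close>, and removing the last
  letter of a word does the same on the other side. The walk can only get stuck at \<open>M\<close>, after using up
  all occurrences of \<open>M\<close>; the next walk is then based at the largest remaining letter \<open>N\<close>. If \<open>N\<close> is
  odd, reversing \<open>u N\<close> turns the condition on its head into one on the first step of that walk. The
  conditions on the heads of the other lists hold automatically, since a violation would leave the walk stuck.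
\<close>

lemma card_pred_lists_words_to:
  assumes "add_mset M k = add_mset c l" "\<forall>x\<in>#k. x \<le> M"
  shows "card (pred_lists {b. odd b \<and> b \<noteq> M} k l) = card (words_to c l)"
  using assms
proof (induction "size k" arbitrary: k l M c rule: less_induct)
  case less
  note kl = less.prems(1) and le = less.prems(2)
  \<comment> \<open>The base \<open>N\<close> is left free because a closed walk is followed by one
    with a new base.\<close>
  have IH: "(\<Sum>a | a \<in># l \<and> P a. card (pred_lists {b. odd b \<and> b \<noteq> N} (k - {#d#}) (l - {#a#}))) =
    (\<Sum>a | a \<in># l \<and> P a. card (words_to a (l - {#a#})))"
    if "add_mset N k = add_mset d l" "d \<in># k" "\<forall>x\<in>#k. x \<le> N" for N d P
  proof (rule sum.cong)
    fix a assume "a \<in> {a. a \<in># l \<and> P a}"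
    then have a: "a \<in># l" by simp
    show "card (pred_lists {b. odd b \<and> b \<noteq> N} (k - {#d#}) (l - {#a#})) = card (words_to a (l - {#a#}))"
    proof (rule less.hyps)
      show "size (k - {#d#}) < size k" using that(2) by (simp add: size_Diff1_less)
      have "add_mset d (add_mset N (k - {#d#})) = add_mset d l"
        using that(1,2) by (metis add_mset_commute insert_DiffM)
      then show "add_mset N (k - {#d#}) = add_mset a (l - {#a#})" using a by simp
      show "\<forall>x\<in>#k - {#d#}. x \<le> N" using that(3) by (auto dest: in_diffD)
    qed
  qed simp
  show ?case
  proof (cases "c \<in># k")
    case True
    \<comment> \<open>An open walk, with \<open>c \<noteq> M\<close>, has one more edge into
      \<open>c\<close> left than out of it. So the only remaining edge into \<open>c\<close> cannot
      start at \<open>c\<close>.\<close>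
    have "count (add_mset M k) c = count (add_mset c l) c" using kl by simp
    then have "c \<in> {b. odd b \<and> b \<noteq> M} \<and> count k c = 1 \<longrightarrow> c \<notin># l"
      by (auto simp: not_in_iff split: if_splits)
    from card_pred_lists_snoc[OF True this, of UNIV]
    have "card (pred_lists {b. odd b \<and> b \<noteq> M} k l) = (\<Sum>a | a \<in># l \<and> trans_ok a c.
      card (pred_lists {b. odd b \<and> b \<noteq> M} (k - {#c#}) (l - {#a#})))" by simp
    also have "\<dots> = (\<Sum>a | a \<in># l \<and> trans_ok a c. card (words_to a (l - {#a#})))"
      by (rule IH) (use kl True le in auto)
    also have "\<dots> = card (words_to c l)"
    proof -
      have "size k = size l" using kl by (metis add_right_cancel size_add_mset Suc_inject)
      then have "l \<noteq> {#}" using True by auto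
      then show ?thesis by (simp add: card_words_to)
    qed
    finally show ?thesis .
  next
    case False
    then have cM: "c = M" using kl by (metis insert_noteq_member)
    then have l: "l = k" using kl by simp
    have lt: "\<forall>x\<in>#k. x < M" using le False cM by (metis le_neq_implies_less)
    show ?thesis
    proof (cases "k = {#}")
      case True
      have "pred_lists {b. odd b \<and> b \<noteq> M} {#} {#} = {\<lambda>_. []}"
        by (auto simp: pred_lists_def)
      moreover have "words_to c {#} = {[]}" by (auto simp: words_to_def)
      ultimately show ?thesis using True l by simp
    next
      case False
      define N where "N = Max (set_mset k)"
      have Nk: "N \<in># k" and Nle: "\<forall>x\<in>#k. x \<le> N" using False by (auto simp: N_def)
      then have "N < M" using lt by blast
      have NM: "add_mset N k = add_mset N l" using l by simp
      \<comment> \<open>Now \<open>c = M\<close> exceeds all remaining letters, so exactly the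
        unbarred ones may step to it. The new base \<open>N\<close> has to select the same
        letters.\<close>
      have "card (words_to c k) = (\<Sum>a | a \<in># k \<and> even a. card (words_to a (k - {#a#})))"
      proof -
        have "trans_ok a c \<longleftrightarrow> even a" if "a \<in># k" for a
          using lt that by (auto simp: trans_ok_def cM)
        then show ?thesis using False by (simp add: card_words_to cong: conj_cong)
      qed
      moreover have "card (pred_lists {b. odd b \<and> b \<noteq> M} k k) =
        (\<Sum>a | a \<in># k \<and> even a. card (words_to a (k - {#a#})))"
      proof -
        have "pred_lists {b. odd b \<and> b \<noteq> M} k k = pred_lists {b. odd b} k k"
          using lt by (auto simp: pred_lists_def) (metis count_eq_zero_iff length_0_conv less_irrefl)
        moreover have "card (pred_lists {b. odd b} k k) =
          card {u \<in> pred_lists {b. odd b \<and> b \<noteq> N} k k. last (u N) \<in> {a. odd N \<longrightarrow> a \<noteq> N}}"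
        proof (cases "odd N")
          case True
          have ne: "u N \<noteq> []" if "u \<in> pred_lists E k k" for u E
            using that Nk by (auto simp: pred_lists_def) (metis count_eq_zero_iff list.size(3))
          have ins: "insert N {b. odd b \<and> b \<noteq> N} = {b. odd b}" using True by auto
          have "{u \<in> pred_lists {b. odd b \<and> b \<noteq> N} k k. u N \<noteq> [] \<longrightarrow> last (u N) \<noteq> N} =
            {u \<in> pred_lists {b. odd b \<and> b \<noteq> N} k k. last (u N) \<in> {a. odd N \<longrightarrow> a \<noteq> N}}"
            using ne True by auto
          with bij_betw_same_card[OF pred_lists_rev[of N "{b. odd b \<and> b \<noteq> N}" k k]] ins
          show ?thesis by simp
        next
          case False
          then have "{b. odd b \<and> b \<noteq> N} = {b. odd b}" by auto
          then show ?thesis using False by simp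
        qed
        moreover have "\<dots> = (\<Sum>a | a \<in># k \<and> trans_ok a N \<and> a \<in> {a. odd N \<longrightarrow> a \<noteq> N}.
          card (pred_lists {b. odd b \<and> b \<noteq> N} (k - {#N#}) (k - {#a#})))"
          by (rule card_pred_lists_snoc) (use Nk in auto)
        moreover have "\<dots> = (\<Sum>a | a \<in># k \<and> trans_ok a N \<and> a \<in> {a. odd N \<longrightarrow> a \<noteq> N}. card (words_to a (k - {#a#})))"
          using IH[of N N "\<lambda>a. trans_ok a N \<and> a \<in> {a. odd N \<longrightarrow> a \<noteq> N}"] Nk Nle l by simp
        \<comment> \<open>As \<open>N\<close> is the largest letter left, every unbarred letter may
          step to it, and a barred one only if it equals \<open>N\<close>; the condition on the last
          entry excludes just that.\<close>
        moreover have "{a. a \<in># k \<and> trans_ok a N \<and> a \<in> {a. odd N \<longrightarrow> a \<noteq> N}} = {a. a \<in># k \<and> even a}"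
          using Nle by (auto simp: trans_ok_def split: if_splits)
        ultimately show ?thesis by simp
      qed
      ultimately show ?thesis using l by simp
    qed
  qed
qed

text \<open>A letter \<open>M\<close> above all letters of \<open>m\<close> is a virtual base point:
  a nonempty word may step to it exactly when its last letter is unbarred, which is the end
  condition of a banner. Any strict upper bound would do for \<open>M\<close>.\<close>

lemma card_pred_lists_banners:
  "card (pred_lists {b. odd b} m m) = card {w. mset w = m \<and> banner w}"
proof -
  define M where "M = Suc (2 * (\<Sum>x\<in>#m. x))"
  have lt: "x < M" if "x \<in># m" for x
    using that by (auto simp: M_def dest!: multi_member_split)
  have "pred_lists {b. odd b} m m = pred_lists {b. odd b \<and> b \<noteq> M} m m"
    using lt by (auto simp: pred_lists_def) (metis count_eq_zero_iff length_0_conv less_irrefl)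
  moreover have "card (pred_lists {b. odd b \<and> b \<noteq> M} m m) = card (words_to M m)"
    by (rule card_pred_lists_words_to) (auto simp: lt less_imp_le)
  moreover have "words_to M m = {w. mset w = m \<and> banner w}"
  proof -
    have "trans_ok (last w) M \<longleftrightarrow> even (last w)" if "mset w = m" "w \<noteq> []" for w
      using lt[of "last w"] that by (auto simp: trans_ok_def)
    then show ?thesis by (auto simp: words_to_def banner_def successively_append_iff)
  qed
  ultimately show ?thesis by simp
qed

section \<open>Generating functions\<close>

text \<open>A formal sum of \<open>t ^ b x * fps_X ^ a x\<close> over a set that may be infinite. A
  sum over an infinite level would be 0 by default, so additivity and products ask for
  \<open>fin_levels\<close>.\<close>

definition gf :: "'b::comm_ring_1 \<Rightarrow> ('a \<Rightarrow> nat) \<Rightarrow> ('a \<Rightarrow> nat) \<Rightarrow> 'a set \<Rightarrow> 'b fps" where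
  "gf t a b A = Abs_fps (\<lambda>s. \<Sum>x | x \<in> A \<and> a x = s. t ^ b x)"

definition fin_levels :: "('a \<Rightarrow> nat) \<Rightarrow> 'a set \<Rightarrow> bool" where
  "fin_levels a A \<longleftrightarrow> (\<forall>s. finite {x. x \<in> A \<and> a x = s})"

lemma fin_levels_subset:
  assumes "fin_levels a B" "A \<subseteq> B"
  shows "fin_levels a A"
proof -
  have "{x. x \<in> A \<and> a x = s} \<subseteq> {x. x \<in> B \<and> a x = s}" for s using assms(2) by blast
  then show ?thesis using assms(1) unfolding fin_levels_def by (metis finite_subset)
qed

lemma gf_Un:
  assumes "fin_levels a A" "fin_levels a B" "A \<inter> B = {}"
  shows "gf t a b (A \<union> B) = gf t a b A + gf t a b B"
proof (rule fps_ext)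
  fix s
  have "{x. x \<in> A \<union> B \<and> a x = s} = {x. x \<in> A \<and> a x = s} \<union> {x. x \<in> B \<and> a x = s}" by auto
  then show "fps_nth (gf t a b (A \<union> B)) s = fps_nth (gf t a b A + gf t a b B) s"
    using assms by (auto simp: gf_def fin_levels_def intro!: sum.union_disjoint)
qed

lemma gf_UN:
  assumes "finite I" "\<And>i. i \<in> I \<Longrightarrow> fin_levels a (A i)" "disjoint_family_on A I"
  shows "gf t a b (\<Union>i\<in>I. A i) = (\<Sum>i\<in>I. gf t a b (A i))"
proof (rule fps_ext)
  fix s
  have "{x. x \<in> (\<Union>i\<in>I. A i) \<and> a x = s} = (\<Union>i\<in>I. {x. x \<in> A i \<and> a x = s})" by auto
  then show "fps_nth (gf t a b (\<Union>i\<in>I. A i)) s = fps_nth (\<Sum>i\<in>I. gf t a b (A i)) s"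
    using assms unfolding disjoint_family_on_def
    by (simp add: gf_def fin_levels_def fps_sum_nth, subst sum.UNION_disjoint, auto) blast
qed

lemma gf_bij:
  assumes h: "bij_betw h A B"
    and a: "\<And>x. x \<in> A \<Longrightarrow> a' (h x) = a x + c" and b: "\<And>x. x \<in> A \<Longrightarrow> b' (h x) = b x + d"
  shows "gf t a' b' B = fps_const (t ^ d) * fps_X ^ c * gf t a b A"
proof (rule fps_ext)
  fix s
  have "bij_betw h {x \<in> A. a x + c = s} (h ` {x \<in> A. a x + c = s})"
    using h by (rule bij_betw_subset) auto
  moreover have "h ` {x \<in> A. a x + c = s} = {x. x \<in> B \<and> a' x = s}"
    using a bij_betw_imp_surj_on[OF h] by force
  ultimately have "bij_betw h {x. x \<in> A \<and> a x + c = s} {x. x \<in> B \<and> a' x = s}" by simp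
  from sum.reindex_bij_betw[OF this, of "\<lambda>x. t ^ b' x"]
  have "fps_nth (gf t a' b' B) s = (\<Sum>x | x \<in> A \<and> a x + c = s. t ^ b' (h x))"
    by (simp add: gf_def)
  also have "\<dots> = (\<Sum>x | x \<in> A \<and> a x + c = s. t ^ (b x + d))"
    by (rule sum.cong) (auto simp: b)
  also have "\<dots> = fps_nth (fps_const (t ^ d) * fps_X ^ c * gf t a b A) s"
  proof (cases "s < c")
    case True
    then have "{x. x \<in> A \<and> a x + c = s} = {}" by auto
    then show ?thesis using True by (simp add: mult.assoc fps_X_power_mult_nth)
  next
    case False
    then have "{x. x \<in> A \<and> a x + c = s} = {x. x \<in> A \<and> a x = s - c}" by auto
    then show ?thesis using False
      by (simp add: mult.assoc fps_X_power_mult_nth gf_def power_add sum_distrib_left mult.commute)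
  qed
  finally show "fps_nth (gf t a' b' B) s = fps_nth (fps_const (t ^ d) * fps_X ^ c * gf t a b A) s" .
qed

lemma gf_Times:
  assumes "fin_levels a A" "fin_levels a' B"
  shows "gf t (\<lambda>(x, y). a x + a' y) (\<lambda>(x, y). b x + b' y) (A \<times> B) = gf t a b A * gf t a' b' B"
proof (rule fps_ext)
  fix s
  have "{p. p \<in> A \<times> B \<and> (case p of (x, y) \<Rightarrow> a x + a' y) = s} =
    (\<Union>i\<in>{0..s}. {x. x \<in> A \<and> a x = i} \<times> {y. y \<in> B \<and> a' y = s - i})" by auto
  then have "fps_nth (gf t (\<lambda>(x, y). a x + a' y) (\<lambda>(x, y). b x + b' y) (A \<times> B)) s =
    (\<Sum>i=0..s. \<Sum>p\<in>{x. x \<in> A \<and> a x = i} \<times> {y. y \<in> B \<and> a' y = s - i}. case p of (x, y) \<Rightarrow> t ^ b x * t ^ b' y)"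
    using assms unfolding gf_def fin_levels_def
    by (auto simp: power_add case_prod_unfold intro!: sum.UNION_disjoint)
  also have "\<dots> = fps_nth (gf t a b A * gf t a' b' B) s"
    by (simp add: fps_mult_nth gf_def sum_product sum.cartesian_product)
  finally show "fps_nth (gf t (\<lambda>(x, y). a x + a' y) (\<lambda>(x, y). b x + b' y) (A \<times> B)) s =
    fps_nth (gf t a b A * gf t a' b' B) s" .
qed

section \<open>The recurrence for banners\<close>

definition val :: "nat list \<Rightarrow> nat" where
  "val w = (\<Sum>x\<leftarrow>w. x div 2)"

definition bars :: "nat list \<Rightarrow> nat" where
  "bars w = length (filter odd w)"

lemma val_simps [simp]: "val [] = 0" "val (x # w) = x div 2 + val w" "val (v @ w) = val v + val w"
  by (auto simp: val_def)

lemma bars_simps [simp]: "bars [] = 0" "bars (x # w) = (if odd x then 1 else 0) + bars w"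
  "bars (v @ w) = bars v + bars w"
  by (auto simp: bars_def)

definition banners :: "nat \<Rightarrow> nat list set" where
  "banners n = {w. length w = n \<and> banner w}"

lemma fin_levels_length: "fin_levels val {w. length w = n \<and> P w}"
  unfolding fin_levels_def
proof
  fix s
  have "x \<le> 2 * s + 1" if "x \<in> set w" "val w = s" for x w
  proof -
    have "x div 2 \<le> val w" unfolding val_def using that(1) by (intro member_le_sum_list) auto
    then show ?thesis using that(2) by linarith
  qed
  then have "{w. w \<in> {w. length w = n \<and> P w} \<and> val w = s} \<subseteq> {w. set w \<subseteq> {..2 * s + 1} \<and> length w = n}"
    by auto
  then show "finite {w. w \<in> {w. length w = n \<and> P w} \<and> val w = s}"
    by (rule finite_subset) (auto intro: finite_lists_length_eq)
qed

lemma fin_levels_banners: "fin_levels val (banners n)"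
  unfolding banners_def by (rule fin_levels_length)

abbreviation banner_gf :: "'b::comm_ring_1 \<Rightarrow> nat \<Rightarrow> 'b fps" where
  "banner_gf t n \<equiv> gf t val bars (banners n)"

lemma banners_0: "banner_gf t 0 = 1"
proof -
  have "banners 0 = {[]}" by (auto simp: banners_def banner_def)
  moreover have "fps_nth (gf t val bars {[]}) s = fps_nth 1 s" for s
  proof (cases s)
    case 0
    then have "{x. x \<in> {[]} \<and> val x = s} = {[]}" by auto
    then show ?thesis using 0 by (simp add: gf_def)
  next
    case (Suc r)
    then have e: "{x. x \<in> {[]} \<and> val x = s} = {}" by auto
    show ?thesis unfolding gf_def fps_nth_Abs_fps e by (simp add: Suc)
  qed
  ultimately show ?thesis by (simp add: fps_eq_iff)
qed

definition high_banners :: "nat \<Rightarrow> nat list set" where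
  "high_banners n = {w \<in> banners n. \<forall>x\<in>set w. 2 \<le> x}"

lemma fin_levels_high_banners: "fin_levels val (high_banners n)"
  by (rule fin_levels_subset[OF fin_levels_banners]) (auto simp: high_banners_def)

text \<open>Adding 2 to every letter raises each value by one and keeps bars and comparisons, so a
  banner of length \<open>n\<close> gains weight \<open>n\<close>. The letters below 2 are the zero
  and the barred zero.\<close>

lemma gf_high_banners: "gf t val bars (high_banners n) = fps_X ^ n * banner_gf t n"
proof -
  let ?h = "map (\<lambda>x. x + 2)"
  have ban: "banner (?h w) = banner w" for w
    by (auto simp: banner_def successively_map last_map trans_ok_def)
  have "bij_betw ?h (banners n) (high_banners n)"
  proof (rule bij_betwI[where g = "map (\<lambda>x. x - 2)"])
    show "?h \<in> banners n \<rightarrow> high_banners n" using ban by (auto simp: banners_def high_banners_def)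
    have id: "?h (map (\<lambda>x. x - 2) w) = w" if "\<forall>x\<in>set w. 2 \<le> x" for w :: "nat list"
      using that by (auto intro!: map_idI)
    show "map (\<lambda>x. x - 2) \<in> high_banners n \<rightarrow> banners n"
      using ban id by (fastforce simp: banners_def high_banners_def)
    show "?h (map (\<lambda>x. x - 2) w) = w" if "w \<in> high_banners n" for w
      using that by (intro id) (auto simp: high_banners_def)
  qed (auto intro!: map_idI)
  moreover have "val (?h w) = val w + length w" "bars (?h w) = bars w" for w by (induction w) auto
  ultimately have "gf t val bars (high_banners n) = fps_const (t ^ 0) * fps_X ^ n * banner_gf t n"
    by (intro gf_bij[where h = ?h]) (auto simp: banners_def)
  then show ?thesis by simp
qed

text \<open>The last letter of value zero is unbarred: a barred zero cannot end a banner, and it may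
  only be followed by another letter of value zero.\<close>

lemma split_last_zero:
  assumes "banner w" "\<not> (\<forall>x\<in>set w. 2 \<le> x)"
  obtains L R where "w = L @ 0 # R" "\<forall>x\<in>set R. 2 \<le> x"
proof -
  have "\<exists>x\<in>set w. \<not> 2 \<le> x" using assms by auto
  from split_list_last_prop[OF this] obtain L z R
    where w: "w = L @ z # R" "\<not> 2 \<le> z" "\<forall>x\<in>set R. 2 \<le> x" by auto
  have "z \<noteq> 1"
  proof
    assume "z = 1"
    then show False using w assms(1)
      by (cases R) (auto simp: banner_def successively_append_iff successively_Cons trans_ok_def)
  qed
  then have "z = 0" using w by auto
  then show ?thesis using w that by blast
qed

lemma append_zero_inject:
  fixes L L' R R' :: "nat list"
  assumes "\<forall>x\<in>set R. 2 \<le> x" "\<forall>x\<in>set R'. 2 \<le> x" "L @ 0 # R = L' @ 0 # R'"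
  shows "L = L' \<and> R = R'"
proof -
  have tw: "takeWhile (\<lambda>x. 2 \<le> x) (rev (L @ 0 # R)) = rev R" if "\<forall>x\<in>set R. 2 \<le> x"
    for L R :: "nat list"
    using that by (simp add: takeWhile_append takeWhile_tail)
  have "rev R = rev R'" using tw[OF assms(1), of L] tw[OF assms(2), of L'] assms(3) by simp
  then show ?thesis using assms(3) by simp
qed

text \<open>On an odd last letter this removes the bar and keeps the value; \<open>inc_last\<close>
  bars an even one.\<close>

definition dec_last :: "nat list \<Rightarrow> nat list" where
  "dec_last w = butlast w @ [last w - 1]"
definition inc_last :: "nat list \<Rightarrow> nat list" where
  "inc_last w = butlast w @ [last w + 1]"

text \<open>A zero may be followed by anything and preceded only by a zero or a barred letter, so
  the two sides interact only through the last letter of \<open>L\<close>.\<close>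

lemma banner_zero_split:
  assumes "\<forall>x\<in>set R. 2 \<le> x"
  shows "banner (L @ 0 # R) \<longleftrightarrow> banner R \<and> successively trans_ok L \<and>
    (L \<noteq> [] \<longrightarrow> odd (last L) \<or> last L = 0)"
  using assms by (auto simp: banner_def successively_append_iff successively_Cons trans_ok_def)

text \<open>
  Write a banner containing a zero as \<open>L 0 R\<close> with no zero in \<open>R\<close>. If \<open>L\<close> is empty or ends with \<open>0\<close>,
  deleting the displayed \<open>0\<close> gives an arbitrary banner; otherwise \<open>L\<close> ends with a barred letter,
  and removing that bar makes \<open>L\<close> a banner.
\<close>

lemma banner_gf_rec:
  "banner_gf t (Suc n) * (1 - fps_X ^ Suc n) =
    banner_gf t n + fps_const t * (\<Sum>k<n. fps_X ^ k * banner_gf t k * banner_gf t (n - k))"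
proof -
  define S1 where "S1 = {w. \<exists>L R. w = L @ 0 # R \<and> w \<in> banners (Suc n) \<and> (\<forall>x\<in>set R. 2 \<le> x) \<and>
    (L = [] \<or> last L = 0)}"
  define S2 where "S2 k = {w. \<exists>L R. w = L @ 0 # R \<and> w \<in> banners (Suc n) \<and> (\<forall>x\<in>set R. 2 \<le> x) \<and>
    length R = k \<and> L \<noteq> [] \<and> odd (last L)}" for k
  have S2ban: "S2 k \<subseteq> banners (Suc n)" for k by (auto simp: S2_def)
  have S1ban: "S1 \<subseteq> banners (Suc n)" by (auto simp: S1_def)
  have finS2: "fin_levels val (S2 k)" for k by (rule fin_levels_subset[OF fin_levels_banners S2ban])
  have finS1: "fin_levels val S1" by (rule fin_levels_subset[OF fin_levels_banners S1ban])
  have disj: "disjoint_family_on S2 {..<n}"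
    by (auto simp: disjoint_family_on_def S2_def dest: append_zero_inject)
  have split: "banners (Suc n) = high_banners (Suc n) \<union> (S1 \<union> (\<Union>k<n. S2 k))"
  proof (intro equalityI subsetI)
    fix w assume w: "w \<in> banners (Suc n)"
    show "w \<in> high_banners (Suc n) \<union> (S1 \<union> (\<Union>k<n. S2 k))"
    proof (cases "\<forall>x\<in>set w. 2 \<le> x")
      case True then show ?thesis using w by (auto simp: high_banners_def)
    next
      case False
      then obtain L R where LR: "w = L @ 0 # R" "\<forall>x\<in>set R. 2 \<le> x"
        using w split_last_zero[of w] by (auto simp: banners_def)
      show ?thesis
      proof (cases "L = [] \<or> last L = 0")
        case True
        then have "w \<in> S1" using LR w unfolding S1_def by blast
        then show ?thesis by blast
      next
        case False
        then have "odd (last L)" using LR w banner_zero_split[of R L] by (auto simp: banners_def)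
        then have "w \<in> S2 (length R)" using LR w False unfolding S2_def by blast
        moreover have "length R < n" using w LR False by (cases L) (auto simp: banners_def)
        ultimately show ?thesis by blast
      qed
    qed
  qed (use S1ban S2ban in \<open>auto simp: high_banners_def\<close>)
  have disj1: "S1 \<inter> (\<Union>k<n. S2 k) = {}"
  proof -
    have False if w1: "w \<in> S1" and w2: "w \<in> S2 k" for w k
    proof -
      obtain L R where L: "w = L @ 0 # R" "\<forall>x\<in>set R. 2 \<le> x" "L = [] \<or> last L = 0"
        using w1 unfolding S1_def by blast
      obtain L' R' where L': "w = L' @ 0 # R'" "\<forall>x\<in>set R'. 2 \<le> x" "L' \<noteq> []" "odd (last L')"
        using w2 unfolding S2_def by blast
      show False using append_zero_inject[of R R' L L'] L L' by auto
    qed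
    then show ?thesis by blast
  qed
  have disj2: "high_banners (Suc n) \<inter> (S1 \<union> (\<Union>k<n. S2 k)) = {}"
    by (auto simp: S1_def S2_def high_banners_def)
  have fin: "fin_levels val (S1 \<union> (\<Union>k<n. S2 k))"
    by (rule fin_levels_subset[OF fin_levels_banners[of "Suc n"]]) (use S1ban S2ban in auto)
  have "banner_gf t (Suc n) = gf t val bars (high_banners (Suc n)) + gf t val bars S1 + (\<Sum>k<n. gf t val bars (S2 k))"
  proof -
    have fin2: "fin_levels val (\<Union>k<n. S2 k)" by (rule fin_levels_subset[OF fin]) blast
    have "banner_gf t (Suc n) = gf t val bars (high_banners (Suc n) \<union> (S1 \<union> (\<Union>k<n. S2 k)))"
      by (simp only: split[symmetric])
    then show ?thesis
      unfolding gf_Un[OF fin_levels_high_banners fin disj2] gf_Un[OF finS1 fin2 disj1]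
        gf_UN[OF finite_lessThan finS2 disj] by (simp only: add.assoc)
  qed
  moreover have "gf t val bars S1 = banner_gf t n"
  proof -
    \<comment> \<open>The zero goes behind the last zero of \<open>v\<close>, or to the front if
      \<open>v\<close> has none. Uniqueness of this cut, shown in \<open>uniq\<close>, justifies the
      definite description.\<close>
    define ins where "ins v = (THE w. \<exists>L R. w = L @ 0 # R \<and> v = L @ R \<and> (\<forall>x\<in>set R. 2 \<le> x) \<and> (L = [] \<or> last L = 0))"
      for v :: "nat list"
    have ex: "\<exists>L R. v = L @ R \<and> (\<forall>x\<in>set R. 2 \<le> x) \<and> (L = [] \<or> last L = 0)" if v: "banner v" for v
    proof (cases "\<forall>x\<in>set v. 2 \<le> x")
      case False
      then obtain L R where "v = L @ 0 # R" "\<forall>x\<in>set R. 2 \<le> x" by (rule split_last_zero[OF v])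
      then show ?thesis by (intro exI[of _ "L @ [0]"] exI[of _ R]) auto
    qed auto
    have uniq: "L = L' \<and> R = R'" if "L @ R = L' @ R'" "\<forall>x\<in>set R. 2 \<le> x" "L = [] \<or> last L = 0"
      "\<forall>x\<in>set R'. 2 \<le> x" "L' = [] \<or> last L' = 0" for L R L' R' :: "nat list"
    proof -
      have tw: "takeWhile (\<lambda>x. 2 \<le> x) (rev (L @ R)) = rev R"
        if "\<forall>x\<in>set R. 2 \<le> x" "L = [] \<or> last L = 0" for L R :: "nat list"
        using that by (cases L rule: rev_cases) (auto simp: takeWhile_append takeWhile_tail)
      have "rev R = rev R'" using tw[OF that(2,3)] tw[OF that(4,5)] that(1) by simp
      then show ?thesis using that(1) by simp
    qed
    have ins: "ins (L @ R) = L @ 0 # R" if "\<forall>x\<in>set R. 2 \<le> x" "L = [] \<or> last L = 0" for L R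
      unfolding ins_def using uniq[OF _ that] that by (intro the_equality) (blast+)
    have ban: "banner (L @ R) \<longleftrightarrow> banner (L @ 0 # R)" if "\<forall>x\<in>set R. 2 \<le> x" "L = [] \<or> last L = 0" for L R
      using that
      by (cases L rule: rev_cases)
         (auto simp: banner_def successively_append_iff successively_Cons trans_ok_def)
    have "bij_betw ins (banners n) S1"
    proof (rule bij_betwI')
      fix v v' assume v: "v \<in> banners n" and v': "v' \<in> banners n"
      obtain L R where L: "v = L @ R" "\<forall>x\<in>set R. 2 \<le> x" "L = [] \<or> last L = 0"
        using ex[of v] v unfolding banners_def by blast
      obtain L' R' where L': "v' = L' @ R'" "\<forall>x\<in>set R'. 2 \<le> x" "L' = [] \<or> last L' = 0"
        using ex[of v'] v' unfolding banners_def by blast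
      show "ins v = ins v' \<longleftrightarrow> v = v'" 
        using append_zero_inject[OF L(2) L'(2), of L L'] ins[OF L(2,3)] ins[OF L'(2,3)] L(1) L'(1) by auto
      show "ins v \<in> S1"
        using L ins[OF L(2,3)] ban[OF L(2,3)] v unfolding S1_def banners_def by auto
    next
      fix w assume "w \<in> S1"
      then obtain L R where w: "w = L @ 0 # R" "w \<in> banners (Suc n)" "\<forall>x\<in>set R. 2 \<le> x" "L = [] \<or> last L = 0"
        unfolding S1_def by blast
      then have "L @ R \<in> banners n" using ban[OF w(3,4)] by (auto simp: banners_def)
      moreover have "w = ins (L @ R)" using ins[OF w(3,4)] w(1) by simp
      ultimately show "\<exists>v\<in>banners n. w = ins v" by blast
    qed
    moreover have "val (ins v) = val v + 0 \<and> bars (ins v) = bars v + 0" if "v \<in> banners n" for v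
    proof -
      obtain L R where L: "v = L @ R" "\<forall>x\<in>set R. 2 \<le> x" "L = [] \<or> last L = 0"
        using ex[of v] \<open>v \<in> banners n\<close> unfolding banners_def by blast
      then show ?thesis using ins[OF L(2,3)] by simp
    qed
    ultimately have "gf t val bars S1 = fps_const (t ^ 0) * fps_X ^ 0 * banner_gf t n"
      by (intro gf_bij[where h = ins]) auto
    then show ?thesis by simp
  qed
  moreover have "gf t val bars (S2 k) = fps_const t * (fps_X ^ k * banner_gf t k * banner_gf t (n - k))"
    if "k < n" for k
  proof -
    let ?h = "\<lambda>(R, L). inc_last L @ 0 # R"
    \<comment> \<open>Barring an even last letter \<open>x\<close> does not disturb the letter
      before it: an even and an odd number never coincide, so an odd predecessor is at least
      \<open>x\<close> iff at least \<open>x + 1\<close>, and an even one at most \<open>x\<close>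
      iff at most \<open>x + 1\<close>.\<close>
    have inc: "successively trans_ok (inc_last L) \<and> odd (last (inc_last L)) \<longleftrightarrow> banner L"
      if "L \<noteq> []" for L
      using that
      by (cases L rule: rev_cases)
         (auto simp: banner_def inc_last_def successively_append_iff trans_ok_def, presburger+)
    have "bij_betw ?h (high_banners k \<times> banners (n - k)) (S2 k)"
    proof (rule bij_betwI')
      fix p p' assume "p \<in> high_banners k \<times> banners (n - k)" "p' \<in> high_banners k \<times> banners (n - k)"
      then obtain R L R' L' where p: "p = (R, L)" "p' = (R', L')" "R \<in> high_banners k" "R' \<in> high_banners k"
        "L \<in> banners (n - k)" "L' \<in> banners (n - k)" by (cases p, cases p') auto
      have "L \<noteq> []" "L' \<noteq> []" using p that by (auto simp: banners_def)
      then have "inc_last L = inc_last L' \<longleftrightarrow> L = L'"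
        by (cases L rule: rev_cases; cases L' rule: rev_cases) (auto simp: inc_last_def)
      then show "?h p = ?h p' \<longleftrightarrow> p = p'" using p append_zero_inject[of R R' "inc_last L" "inc_last L'"]
        by (auto simp: high_banners_def)
      have "banner (inc_last L @ 0 # R)"
        using p inc[OF \<open>L \<noteq> []\<close>] banner_zero_split[of R "inc_last L"] by (auto simp: high_banners_def banners_def)
      moreover have "length (inc_last L) = length L" "inc_last L \<noteq> []" using \<open>L \<noteq> []\<close> by (auto simp: inc_last_def)
      ultimately show "?h p \<in> S2 k"
        using p inc[OF \<open>L \<noteq> []\<close>] that unfolding S2_def by (auto simp: high_banners_def banners_def)
    next
      fix w assume "w \<in> S2 k"
      then obtain L R where w: "w = L @ 0 # R" "w \<in> banners (Suc n)" "\<forall>x\<in>set R. 2 \<le> x"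
        "length R = k" "L \<noteq> []" "odd (last L)" unfolding S2_def by blast
      have L: "inc_last (dec_last L) = L" "dec_last L \<noteq> []" "length (dec_last L) = length L"
        using w(5,6) by (cases L rule: rev_cases; auto simp: inc_last_def dec_last_def)+
      have "banner R" "successively trans_ok L" using w banner_zero_split[of R L] by (auto simp: banners_def)
      then have "(R, dec_last L) \<in> high_banners k \<times> banners (n - k)"
        using w L inc[of "dec_last L"] by (auto simp: high_banners_def banners_def)
      then show "\<exists>p\<in>high_banners k \<times> banners (n - k). w = ?h p" using L w by force
    qed
    moreover have "val (?h p) = (case p of (x, y) \<Rightarrow> val x + val y) + 0 \<and>
      bars (?h p) = (case p of (x, y) \<Rightarrow> bars x + bars y) + 1"
      if pp: "p \<in> high_banners k \<times> banners (n - k)" for p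
    proof -
      obtain R L where p: "p = (R, L)" "L \<in> banners (n - k)" using pp by auto
      then have "L \<noteq> []" "even (last L)" using \<open>k < n\<close> by (auto simp: banners_def banner_def)
      then show ?thesis using p by (cases L rule: rev_cases) (auto simp: inc_last_def)
    qed
    ultimately have "gf t val bars (S2 k) = fps_const (t ^ 1) * fps_X ^ 0 *
      gf t (\<lambda>(x, y). val x + val y) (\<lambda>(x, y). bars x + bars y) (high_banners k \<times> banners (n - k))"
      by (intro gf_bij[where h = ?h]) blast+
    then show ?thesis
      by (simp add: gf_Times fin_levels_high_banners fin_levels_banners gf_high_banners)
  qed
  ultimately have "banner_gf t (Suc n) = fps_X ^ Suc n * banner_gf t (Suc n) + banner_gf t n +
    (\<Sum>k<n. fps_const t * (fps_X ^ k * banner_gf t k * banner_gf t (n - k)))"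
    by (simp add: gf_high_banners)
  then show ?thesis by (simp add: sum_distrib_left algebra_simps del: power_Suc)
qed

section \<open>Permutations as predecessor lists\<close>

text \<open>
  The letter \<open>g i\<close> sits at position \<open>i\<close> of the filling, and its bar marks an excedance.
\<close>

definition compatible :: "nat \<Rightarrow> (nat \<Rightarrow> nat) \<Rightarrow> (nat \<Rightarrow> nat) \<Rightarrow> bool" where
  "compatible n g \<sigma> \<longleftrightarrow> \<sigma> permutes {1..n} \<and>
     (\<forall>i\<in>{1..n}. \<forall>j\<in>{1..n}. i < j \<and> g i = g j \<longrightarrow> \<sigma> i < \<sigma> j) \<and>
     (\<forall>i\<in>{1..n}. odd (g i) \<longleftrightarrow> i < \<sigma> i)"

definition block :: "nat \<Rightarrow> (nat \<Rightarrow> nat) \<Rightarrow> nat \<Rightarrow> nat set" where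
  "block n g b = {j \<in> {1..n}. g j = b}"

lemma finite_block [simp]: "finite (block n g b)"
  by (simp add: block_def)

section \<open>Increasing maps and multisets of fibres\<close>

lemma ex_strict_mono_bij:
  fixes A B :: "nat set"
  assumes "finite A" "finite B" "card A = card B"
  shows "\<exists>h. bij_betw h A B \<and> strict_mono_on A h"
proof -
  obtain h1 where h1: "bij_betw h1 {..<card A} A" "strict_mono_on {..<card A} h1"
    using ex_bij_betw_strict_mono_card[OF assms(1)] .
  obtain h2 where h2: "bij_betw h2 {..<card A} B" "strict_mono_on {..<card A} h2"
    using ex_bij_betw_strict_mono_card[OF assms(2)] assms(3) by metis
  define k where "k = the_inv_into {..<card A} h1"
  have k: "bij_betw k A {..<card A}" unfolding k_def using h1(1) by (rule bij_betw_the_inv_into)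
  have hk: "h1 (k x) = x" if "x \<in> A" for x
    unfolding k_def using h1(1) that by (metis bij_betw_def f_the_inv_into_f)
  have "strict_mono_on A (h2 \<circ> k)"
  proof (rule strict_mono_onI)
    fix x y assume xy: "x \<in> A" "y \<in> A" "x < y"
    have kx: "k x \<in> {..<card A}" "k y \<in> {..<card A}" using k xy by (auto simp: bij_betw_def)
    have "k x < k y"
    proof (rule ccontr)
      assume "\<not> k x < k y"
      then have "h1 (k y) \<le> h1 (k x)" using h1(2) kx
        by (metis strict_mono_onD linorder_not_le order.order_iff_strict)
      then show False using hk xy by simp
    qed
    then show "(h2 \<circ> k) x < (h2 \<circ> k) y" using h2(2) kx by (simp add: strict_mono_onD)
  qed
  moreover have "bij_betw (h2 \<circ> k) A B" using k h2(1) by (rule bij_betw_trans)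
  ultimately show ?thesis by blast
qed

text \<open>Along the increasing enumeration of \<open>A\<close>, both maps list their common image
  in sorted order.\<close>

lemma strict_mono_on_image_unique:
  fixes \<sigma> \<tau> :: "nat \<Rightarrow> nat"
  assumes "finite A" "strict_mono_on A \<sigma>" "strict_mono_on A \<tau>" "\<sigma> ` A = \<tau> ` A" "x \<in> A"
  shows "\<sigma> x = \<tau> x"
proof -
  have sorted: "sorted (map f (sorted_list_of_set A))" if "strict_mono_on A f" for f :: "nat \<Rightarrow> nat"
    using assms(1) that
    by (auto simp: sorted_map intro!: sorted_wrt_mono_rel[OF _ sorted_sorted_list_of_set])
       (metis order.order_iff_strict strict_mono_onD)
  have dist: "distinct (map f (sorted_list_of_set A))" if "strict_mono_on A f" for f :: "nat \<Rightarrow> nat"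
    using assms(1) that by (auto simp: distinct_map strict_mono_on_imp_inj_on)
  have "map \<sigma> (sorted_list_of_set A) = map \<tau> (sorted_list_of_set A)"
    by (rule sorted_distinct_set_unique) (use sorted dist assms in auto)
  then show ?thesis using assms(1,5) by simp
qed

lemma sum_mset_fibres:
  assumes "finite A"
  shows "(\<Sum>b\<in>g ` A. image_mset w (mset_set {a \<in> A. g a = b})) = image_mset w (mset_set A)"
proof -
  have single: "(\<Sum>a\<in>B. {#w a#}) = image_mset w (mset_set B)" if "finite B" for B
    using that by (induction B rule: finite_induct) auto
  have "image_mset w (mset_set A) = (\<Sum>b\<in>g ` A. \<Sum>a | a \<in> A \<and> g a = b. {#w a#})"
    using sum.image_gen[OF assms, of "\<lambda>a. {#w a#}" g] single[OF assms] by simp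
  also have "\<dots> = (\<Sum>b\<in>g ` A. image_mset w (mset_set {a \<in> A. g a = b}))"
    using assms by (intro sum.cong single) auto
  finally show ?thesis by simp
qed

lemma count_image_mset_set:
  assumes "finite A"
  shows "count (image_mset f (mset_set A)) b = card {a \<in> A. f a = b}"
  using assms
proof (induction A rule: finite_induct)
  case (insert x F)
  have "{a \<in> insert x F. f a = b} = (if f x = b then insert x {a \<in> F. f a = b} else {a \<in> F. f a = b})"
    by auto
  then show ?case using insert by simp
qed simp

text \<open>From left to right, \<open>g\<close> is weakly decreasing and a block minimum is at most
  each of its positions. The converse is a pigeonhole argument on blocks, which are intervals. For a
  barred block starting at \<open>a\<close>, \<open>\<sigma>\<close> maps \<open>{a..i}\<close>
  injectively into \<open>{a<..\<sigma> i}\<close>, where the exclusion of the minimum removes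
  \<open>a\<close>; comparing sizes gives \<open>i < \<sigma> i\<close>. For an unbarred block
  ending at \<open>a\<close>, \<open>\<sigma>\<close> maps \<open>{i..a}\<close> into
  \<open>{\<sigma> i..a}\<close>, whence \<open>\<sigma> i \<le> i\<close>.\<close>

lemma excedance_iff_trans_ok:
  assumes p: "\<sigma> permutes {1..n}"
    and anti: "\<And>i j. i \<in> {1..n} \<Longrightarrow> j \<in> {1..n} \<Longrightarrow> i \<le> j \<Longrightarrow> g j \<le> g i"
    and incr: "\<forall>i\<in>{1..n}. \<forall>j\<in>{1..n}. i < j \<and> g i = g j \<longrightarrow> \<sigma> i < \<sigma> j"
  shows "(\<forall>i\<in>{1..n}. odd (g i) \<longleftrightarrow> i < \<sigma> i) \<longleftrightarrow>
    (\<forall>i\<in>{1..n}. trans_ok (g i) (g (\<sigma> i)) \<and> (odd (g i) \<longrightarrow> \<sigma> i \<noteq> Min (block n g (g i))))"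
    (is "?L \<longleftrightarrow> ?R")
proof
  have in_n: "\<sigma> i \<in> {1..n} \<longleftrightarrow> i \<in> {1..n}" for i by (rule permutes_in_image[OF p])
  {
    assume L: ?L
    show ?R
    proof (intro ballI conjI impI)
      fix i assume i: "i \<in> {1..n}"
      then have s: "\<sigma> i \<in> {1..n}" by (simp only: in_n)
      show "trans_ok (g i) (g (\<sigma> i))"
        using L i anti[OF i s] anti[OF s i] by (auto simp: trans_ok_def)
      assume "odd (g i)"
      then have "i < \<sigma> i" using L i by blast
      moreover have "Min (block n g (g i)) \<le> i" using i by (intro Min_le) (auto simp: block_def)
      ultimately show "\<sigma> i \<noteq> Min (block n g (g i))" by simp
    qed
  next
    assume R: ?R
    show ?L
    proof
      fix i assume i: "i \<in> {1..n}"
      let ?B = "block n g (g i)"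
      have iB: "i \<in> ?B" using i by (simp add: block_def)
      have inj: "inj_on \<sigma> S" for S using p by (metis permutes_inj inj_on_subset subset_UNIV)
      have le: "\<sigma> i' \<le> \<sigma> i''" if "i' \<in> ?B" "i'' \<in> ?B" "i' \<le> i''" for i' i''
        using incr[rule_format, of i' i''] that by (cases "i' = i''") (auto simp: block_def)
      have odd: "i < \<sigma> i" if o: "odd (g i)"
      proof -
        define a where "a = Min ?B"
        have aB: "a \<in> ?B" unfolding a_def using iB by (intro Min_in) auto
        have amin: "a \<le> j" if "j \<in> ?B" for j unfolding a_def using that by (intro Min_le) auto
        have "\<sigma> ` {a..i} \<subseteq> {a<..\<sigma> i}"
        proof
          fix x assume "x \<in> \<sigma> ` {a..i}"
          then obtain i' where i': "x = \<sigma> i'" "a \<le> i'" "i' \<le> i" by auto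
          have i'n: "i' \<in> {1..n}" using i' aB i by (auto simp: block_def)
          have "g i' = g i" using anti[of a i'] anti[of i' i] i' i'n i aB by (auto simp: block_def)
          then have i'B: "i' \<in> ?B" using i'n by (simp add: block_def)
          have xn: "x \<in> {1..n}" using i'n in_n i' by blast
          have tr: "g x \<le> g i" using R[rule_format, OF i'n] o \<open>g i' = g i\<close> i' by (auto simp: trans_ok_def)
          have "a \<le> x"
          proof (rule ccontr)
            assume "\<not> a \<le> x"
            then have "g a \<le> g x" using anti[of x a] xn aB by (auto simp: block_def)
            then have "x \<in> ?B" using tr xn aB by (auto simp: block_def)
            then show False using amin \<open>\<not> a \<le> x\<close> by blast
          qed
          moreover have "x \<noteq> a" using R[rule_format, OF i'n] o \<open>g i' = g i\<close> i' by (auto simp: a_def)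
          moreover have "x \<le> \<sigma> i" using le[OF i'B iB] i' by simp
          ultimately show "x \<in> {a<..\<sigma> i}" by simp
        qed
        then have "card (\<sigma> ` {a..i}) \<le> card {a<..\<sigma> i}" by (intro card_mono) auto
        then show ?thesis using amin[OF iB] by (simp add: card_image[OF inj])
      qed
      moreover have "\<sigma> i \<le> i" if e: "even (g i)"
      proof -
        define a where "a = Max ?B"
        have aB: "a \<in> ?B" unfolding a_def using iB by (intro Max_in) auto
        have amax: "j \<le> a" if "j \<in> ?B" for j unfolding a_def using that by (intro Max_ge) auto
        have "\<sigma> ` {i..a} \<subseteq> {\<sigma> i..a}"
        proof
          fix x assume "x \<in> \<sigma> ` {i..a}"
          then obtain i' where i': "x = \<sigma> i'" "i \<le> i'" "i' \<le> a" by auto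
          have i'n: "i' \<in> {1..n}" using i' aB i by (auto simp: block_def)
          have "g i' = g i" using anti[of i' a] anti[of i i'] i' i'n i aB by (auto simp: block_def)
          then have i'B: "i' \<in> ?B" using i'n by (simp add: block_def)
          have xn: "x \<in> {1..n}" using i'n in_n i' by blast
          have tr: "g i \<le> g x" using R[rule_format, OF i'n] e \<open>g i' = g i\<close> i' by (auto simp: trans_ok_def)
          have "x \<le> a"
          proof (rule ccontr)
            assume "\<not> x \<le> a"
            then have "g x \<le> g a" using anti[of a x] xn aB by (auto simp: block_def)
            then have "x \<in> ?B" using tr xn aB by (auto simp: block_def)
            then show False using amax \<open>\<not> x \<le> a\<close> by blast
          qed
          moreover have "\<sigma> i \<le> x" using le[OF iB i'B] i' by simp
          ultimately show "x \<in> {\<sigma> i..a}" by simp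
        qed
        then have "card (\<sigma> ` {i..a}) \<le> card {\<sigma> i..a}" by (intro card_mono) auto
        then show ?thesis using amax[OF iB] by (simp add: card_image[OF inj])
      qed
      ultimately show "odd (g i) \<longleftrightarrow> i < \<sigma> i" by (metis linorder_not_less)
    qed
  }
qed

text \<open>Writing at each position \<open>j\<close> the letter of its preimage loses nothing: the
  positions carrying \<open>a\<close> form the image of block \<open>a\<close>, and
  \<open>\<sigma>\<close> increases on that block. Conversely, predecessor lists with the content of
  \<open>m\<close> prescribe image sets of the right sizes, and the increasing bijections onto them
  assemble to a permutation.\<close>

lemma card_compatible:
  assumes anti: "\<And>i j. i \<in> {1..n} \<Longrightarrow> j \<in> {1..n} \<Longrightarrow> i \<le> j \<Longrightarrow> g j \<le> g i"
    and m: "m = image_mset g (mset_set {1..n})"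
  shows "card {\<sigma>. compatible n g \<sigma>} = card (pred_lists {b. odd b} m m)"
proof -
  define sl where "sl b = sorted_list_of_set (block n g b)" for b
  define U where "U \<sigma> b = map (\<lambda>j. g (inv \<sigma> j)) (sl b)" for \<sigma> :: "nat \<Rightarrow> nat" and b
  have set_sl [simp]: "set (sl b) = block n g b" and dist_sl: "distinct (sl b)" for b
    by (simp_all add: sl_def)
  have mset_sl: "mset (sl b) = mset_set (block n g b)" for b
    by (simp add: sl_def flip: sorted_list_of_mset_set)
  have set_m: "set_mset m = g ` {1..n}" by (simp add: m)
  have count_m: "count m b = card (block n g b)" for b
    by (simp add: m block_def count_image_mset_set)
  have len_sl: "length (sl b) = count m b" for b
    using dist_sl[of b] by (simp add: count_m flip: distinct_card)
  have sum_sl: "(\<Sum>b\<in>set_mset m. mset (map w (sl b))) = image_mset w (mset_set {1..n})" for w :: "nat \<Rightarrow> nat"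
    using sum_mset_fibres[of "{1..n}" w g] by (simp add: mset_sl set_m block_def)
  have hd_sl: "hd (sl b) = Min (block n g b)" if "block n g b \<noteq> {}" for b
    using that by (simp add: sl_def sorted_list_of_set_nonempty)
  have cond: "U \<sigma> \<in> pred_lists {b. odd b} m m \<longleftrightarrow> (\<forall>i\<in>{1..n}. odd (g i) \<longleftrightarrow> i < \<sigma> i)"
    if p: "\<sigma> permutes {1..n}" and incr: "\<forall>i\<in>{1..n}. \<forall>j\<in>{1..n}. i < j \<and> g i = g j \<longrightarrow> \<sigma> i < \<sigma> j" for \<sigma>
  proof -
    have "image_mset (\<lambda>j. g (inv \<sigma> j)) (mset_set {1..n}) = image_mset g (image_mset (inv \<sigma>) (mset_set {1..n}))"
      by (simp add: image_mset.compositionality comp_def)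
    also have "image_mset (inv \<sigma>) (mset_set {1..n}) = mset_set {1..n}"
      using permutes_inv[OF p] by (simp add: image_mset_mset_set permutes_inj_on permutes_image)
    finally have s: "(\<Sum>b\<in>set_mset m. mset (U \<sigma> b)) = m"
      unfolding U_def using sum_sl[of "\<lambda>j. g (inv \<sigma> j)"] m by simp
    have "U \<sigma> \<in> pred_lists {b. odd b} m m \<longleftrightarrow>
      (\<forall>b. \<forall>j\<in>block n g b. trans_ok (g (inv \<sigma> j)) b) \<and>
      (\<forall>b. odd b \<and> block n g b \<noteq> {} \<longrightarrow> g (inv \<sigma> (Min (block n g b))) \<noteq> b)"
    proof -
      have "U \<sigma> b \<noteq> [] \<longleftrightarrow> block n g b \<noteq> {}" for b unfolding U_def by (metis map_is_Nil_conv set_empty set_sl)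
      moreover have "hd (U \<sigma> b) = g (inv \<sigma> (Min (block n g b)))" if "block n g b \<noteq> {}" for b
        using that unfolding U_def by (metis hd_map hd_sl set_empty set_sl)
      moreover have "length (U \<sigma> b) = count m b" for b by (simp add: U_def len_sl)
      moreover have "set (U \<sigma> b) = (\<lambda>j. g (inv \<sigma> j)) ` block n g b" for b by (simp add: U_def)
      ultimately show ?thesis using s by (auto simp: pred_lists_def)
    qed
    also have "(\<forall>b. \<forall>j\<in>block n g b. trans_ok (g (inv \<sigma> j)) b) \<longleftrightarrow> (\<forall>i\<in>{1..n}. trans_ok (g i) (g (\<sigma> i)))"
    proof -
      have "(\<forall>b. \<forall>j\<in>block n g b. trans_ok (g (inv \<sigma> j)) b) \<longleftrightarrow> (\<forall>j\<in>{1..n}. trans_ok (g (inv \<sigma> j)) (g j))"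
        by (auto simp: block_def)
      also have "\<dots> \<longleftrightarrow> (\<forall>j\<in>\<sigma> ` {1..n}. trans_ok (g (inv \<sigma> j)) (g j))" by (simp only: permutes_image[OF p])
      also have "\<dots> \<longleftrightarrow> (\<forall>i\<in>{1..n}. trans_ok (g i) (g (\<sigma> i)))" by (simp add: permutes_inverses[OF p])
      finally show ?thesis .
    qed
    also have "(\<forall>b. odd b \<and> block n g b \<noteq> {} \<longrightarrow> g (inv \<sigma> (Min (block n g b))) \<noteq> b) \<longleftrightarrow>
      (\<forall>i\<in>{1..n}. odd (g i) \<longrightarrow> \<sigma> i \<noteq> Min (block n g (g i)))"
    proof (intro iffI ballI allI impI notI)
      fix i assume *: "\<forall>b. odd b \<and> block n g b \<noteq> {} \<longrightarrow> g (inv \<sigma> (Min (block n g b))) \<noteq> b"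
        "i \<in> {1..n}" "odd (g i)" "\<sigma> i = Min (block n g (g i))"
      have "block n g (g i) \<noteq> {}" using *(2) by (auto simp: block_def)
      then show False using * by (metis permutes_inverses(2)[OF p])
    next
      fix b assume *: "\<forall>i\<in>{1..n}. odd (g i) \<longrightarrow> \<sigma> i \<noteq> Min (block n g (g i))"
        "odd b \<and> block n g b \<noteq> {}" "g (inv \<sigma> (Min (block n g b))) = b"
      have "Min (block n g b) \<in> block n g b" using * by (intro Min_in) auto
      then have "inv \<sigma> (Min (block n g b)) \<in> {1..n}"
        using permutes_in_image[OF permutes_inv[OF p]] by (auto simp: block_def)
      then show False using * permutes_inverses(1)[OF p] by metis
    qed
    also have "(\<forall>i\<in>{1..n}. trans_ok (g i) (g (\<sigma> i))) \<and> (\<forall>i\<in>{1..n}. odd (g i) \<longrightarrow> \<sigma> i \<noteq> Min (block n g (g i))) \<longleftrightarrow>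
      (\<forall>i\<in>{1..n}. odd (g i) \<longleftrightarrow> i < \<sigma> i)"
      using excedance_iff_trans_ok[OF p anti incr] by blast
    finally show ?thesis .
  qed
  have "bij_betw U {\<sigma>. compatible n g \<sigma>} (pred_lists {b. odd b} m m)"
  proof (rule bij_betwI')
    fix \<sigma> \<tau> assume "\<sigma> \<in> {\<sigma>. compatible n g \<sigma>}" "\<tau> \<in> {\<sigma>. compatible n g \<sigma>}"
    then have s: "\<sigma> permutes {1..n}" "\<forall>i\<in>{1..n}. \<forall>j\<in>{1..n}. i < j \<and> g i = g j \<longrightarrow> \<sigma> i < \<sigma> j"
      "\<forall>i\<in>{1..n}. odd (g i) \<longleftrightarrow> i < \<sigma> i"
      and t: "\<tau> permutes {1..n}" "\<forall>i\<in>{1..n}. \<forall>j\<in>{1..n}. i < j \<and> g i = g j \<longrightarrow> \<tau> i < \<tau> j"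
      by (auto simp: compatible_def)
    show "U \<sigma> \<in> pred_lists {b. odd b} m m" using cond[OF s(1,2)] s(3) by blast
    show "U \<sigma> = U \<tau> \<longleftrightarrow> \<sigma> = \<tau>"
    proof
      assume eq: "U \<sigma> = U \<tau>"
      have inv_eq: "g (inv \<sigma> j) = g (inv \<tau> j)" if "j \<in> {1..n}" for j
      proof -
        have "U \<sigma> (g j) = U \<tau> (g j)" using eq by simp
        moreover have "j \<in> set (sl (g j))" using that by (simp add: block_def)
        ultimately show ?thesis by (simp add: U_def)
      qed
      have img: "\<rho> ` block n g a = {j \<in> {1..n}. g (inv \<rho> j) = a}" if "\<rho> permutes {1..n}" for \<rho> a
      proof (intro equalityI subsetI)
        fix x assume "x \<in> \<rho> ` block n g a"
        then obtain i where "x = \<rho> i" "i \<in> block n g a" by blast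
        then show "x \<in> {j \<in> {1..n}. g (inv \<rho> j) = a}"
          using permutes_in_image[OF that, of i] permutes_inverses(2)[OF that, of i] by (simp add: block_def)
      next
        fix x assume "x \<in> {j \<in> {1..n}. g (inv \<rho> j) = a}"
        then have "inv \<rho> x \<in> block n g a"
          using permutes_in_image[OF permutes_inv[OF that], of x] by (simp add: block_def)
        then show "x \<in> \<rho> ` block n g a" using permutes_inverses(1)[OF that, of x] by force
      qed
      have "\<sigma> i = \<tau> i" if i: "i \<in> {1..n}" for i
      proof (rule strict_mono_on_image_unique[of "block n g (g i)" \<sigma> \<tau> i])
        show "\<sigma> ` block n g (g i) = \<tau> ` block n g (g i)"
          using inv_eq by (auto simp: img[OF s(1)] img[OF t(1)])
        show "strict_mono_on (block n g (g i)) \<sigma>" "strict_mono_on (block n g (g i)) \<tau>"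
          using s(2) t(2) by (auto simp: block_def intro!: strict_mono_onI)
      qed (use i in \<open>auto simp: block_def\<close>)
      moreover have "\<sigma> i = \<tau> i" if "i \<notin> {1..n}" for i
        using that s(1) t(1) by (simp add: permutes_not_in)
      ultimately show "\<sigma> = \<tau>" by blast
    qed simp
  next
    fix u assume u: "u \<in> pred_lists {b. odd b} m m"
    \<comment> \<open>The entry of \<open>u\<close> that belongs to position \<open>j\<close>, found
      by aligning the sorted block of \<open>j\<close> with its list; it will be the letter at the
      preimage of \<open>j\<close>.\<close>
    define w where "w j = the (map_of (zip (sl (g j)) (u (g j))) j)" for j
    have len_u: "length (u b) = count m b" for b using u by (simp add: pred_lists_def)
    have map_w: "map w (sl b) = u b" for b
    proof (rule nth_equalityI)
      fix i assume "i < length (map w (sl b))"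
      then have i: "i < length (sl b)" by simp
      then have "sl b ! i \<in> block n g b" using set_sl nth_mem by blast
      then have "g (sl b ! i) = b" by (simp add: block_def)
      then show "map w (sl b) ! i = u b ! i"
        using i by (simp add: w_def len_u len_sl map_of_zip_nth dist_sl)
    qed (simp add: len_u len_sl)
    have "image_mset w (mset_set {1..n}) = m"
      using u sum_sl[of w] by (simp only: map_w pred_lists_def mem_Collect_eq)
    then have "count (image_mset w (mset_set {1..n})) a = card (block n g a)" for a by (simp add: count_m)
    then have "card {j \<in> {1..n}. w j = a} = card (block n g a)" for a
      by (simp add: count_image_mset_set)
    then have "\<forall>a. \<exists>h. bij_betw h (block n g a) {j \<in> {1..n}. w j = a} \<and> strict_mono_on (block n g a) h"
      by (intro allI ex_strict_mono_bij) auto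
    then obtain h where h: "\<And>a. bij_betw (h a) (block n g a) {j \<in> {1..n}. w j = a}"
      "\<And>a. strict_mono_on (block n g a) (h a)" by metis
    define \<sigma> where "\<sigma> i = (if i \<in> {1..n} then h (g i) i else i)" for i
    have s: "\<sigma> i \<in> {1..n} \<and> w (\<sigma> i) = g i" if "i \<in> {1..n}" for i
    proof -
      have "h (g i) i \<in> {j \<in> {1..n}. w j = g i}"
        using h(1)[of "g i"] that by (auto simp: bij_betw_def block_def)
      then show ?thesis using that by (simp add: \<sigma>_def)
    qed
    have "inj_on \<sigma> {1..n}"
    proof (rule inj_onI)
      fix i j assume ij: "i \<in> {1..n}" "j \<in> {1..n}" "\<sigma> i = \<sigma> j"
      then have "g i = g j" using s by metis
      then show "i = j" using ij bij_betw_imp_inj_on[OF h(1)[of "g i"]]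
        by (auto simp: \<sigma>_def inj_on_def block_def)
    qed
    moreover have "\<sigma> ` {1..n} \<subseteq> {1..n}" using s by blast
    ultimately have "bij_betw \<sigma> {1..n} {1..n}" by (simp add: bij_betw_def endo_inj_surj)
    then have p: "\<sigma> permutes {1..n}" by (rule bij_imp_permutes) (auto simp: \<sigma>_def)
    have incr: "\<forall>i\<in>{1..n}. \<forall>j\<in>{1..n}. i < j \<and> g i = g j \<longrightarrow> \<sigma> i < \<sigma> j"
      using h(2) by (auto simp: \<sigma>_def block_def strict_mono_on_def)
    have "g (inv \<sigma> j) = w j" if "j \<in> {1..n}" for j
      using s[of "inv \<sigma> j"] that permutes_in_image[OF permutes_inv[OF p]] permutes_inverses[OF p] by simp
    then have "U \<sigma> b = map w (sl b)" for b
      unfolding U_def by (intro map_cong) (auto simp: block_def)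
    then have U: "U \<sigma> = u" using map_w by auto
    then have "compatible n g \<sigma>" using cond[OF p incr] u p incr by (simp add: compatible_def)
    then show "\<exists>\<sigma>\<in>{\<sigma>. compatible n g \<sigma>}. u = U \<sigma>" using U by blast
  qed
  then show ?thesis by (rule bij_betw_same_card)
qed

section \<open>The pair (maj, exc)\<close>

definition dex :: "nat \<Rightarrow> (nat \<Rightarrow> nat) \<Rightarrow> nat set" where
  "dex n \<sigma> = {i \<in> {1..n - 1}. (i < \<sigma> i \<longleftrightarrow> i + 1 < \<sigma> (i + 1)) \<and> \<sigma> (i + 1) < \<sigma> i \<or>
     \<not> i < \<sigma> i \<and> i + 1 < \<sigma> (i + 1)}"

text \<open>\<open>DES\<close> and \<open>dex\<close> differ only where the marking changes: a
  marked letter before an unmarked one is a descent of the word alone, and an unmarked one before a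
  marked one lies in \<open>dex\<close> alone. Hence the indicators satisfy
  \<open>DES + e (i + 1) = dex + e i\<close>. Weighted by \<open>i\<close> and summed, an excedance
  at \<open>i\<close> contributes \<open>i - (i - 1) = 1\<close>; there is no boundary term because
  \<open>n\<close> is never an excedance.\<close>

lemma maj_eq_dex:
  assumes p: "\<sigma> permutes {1..n}"
  shows "maj n \<sigma> = \<Sum> (dex n \<sigma>) + exc n \<sigma>"
proof (cases "n = 0")
  case True
  then show ?thesis by (simp add: maj_def DES_def dex_def exc_def)
next
  case False
  define e :: "nat \<Rightarrow> nat" where "e i = of_bool (i < \<sigma> i)" for i
  have sum_bool: "\<Sum> {i \<in> {1..n - 1}. P i} = (\<Sum>i=1..n - 1. i * of_bool (P i))" for P :: "nat \<Rightarrow> bool"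
  proof -
    have "\<Sum> {i \<in> {1..n - 1}. P i} = (\<Sum>i=1..n - 1. if P i then i else 0)"
      by (rule sum.inter_filter) simp
    also have "\<dots> = (\<Sum>i=1..n - 1. i * of_bool (P i))" by (intro sum.cong) auto
    finally show ?thesis .
  qed
  have step: "i * of_bool (\<sigma> i > \<sigma> (i + 1)) + i * e (i + 1) =
    i * of_bool ((i < \<sigma> i \<longleftrightarrow> i + 1 < \<sigma> (i + 1)) \<and> \<sigma> (i + 1) < \<sigma> i \<or> \<not> i < \<sigma> i \<and> i + 1 < \<sigma> (i + 1)) + i * e i" for i
  proof -
    have "\<sigma> i \<noteq> \<sigma> (i + 1)" using permutes_inj[OF p] by (metis inj_eq less_add_one less_irrefl)
    then show ?thesis by (auto simp: e_def)
  qed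
  have "\<sigma> n \<in> {1..n}" using permutes_in_image[OF p, of n] False by simp
  then have en: "e n = 0" by (simp add: e_def)
  have tele: "(\<Sum>i=1..k. i * e i) + k * e (k + 1) = (\<Sum>i=1..k. i * e (i + 1)) + (\<Sum>i=1..k. e i)" for k
  proof (induction k)
    case (Suc k)
    then show ?case by (simp add: algebra_simps)
  qed simp
  have "exc n \<sigma> = (\<Sum>i=1..n - 1. e i)"
    by (simp add: exc_def e_def of_bool_def flip: sum.inter_filter)
  moreover have "maj n \<sigma> + (\<Sum>i=1..n - 1. i * e (i + 1)) = \<Sum> (dex n \<sigma>) + (\<Sum>i=1..n - 1. i * e i)"
    unfolding maj_def DES_def dex_def sum_bool sum.distrib[symmetric]
    by (rule sum.cong[OF refl], rule step)
  moreover have "(\<Sum>i=1..n - 1. i * e i) = (\<Sum>i=1..n - 1. i * e (i + 1)) + (\<Sum>i=1..n - 1. e i)"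
    using tele[of "n - 1"] False en by simp
  ultimately show ?thesis by linarith
qed

section \<open>Weakly decreasing lists with prescribed drops\<close>

text \<open>Lists are indexed from 0 and elements of \<open>D\<close> from 1, so
  \<open>Suc i\<close> names the place of the entry \<open>f ! i\<close>, after which the drop is
  strict.\<close>

definition drops :: "nat set \<Rightarrow> nat list \<Rightarrow> bool" where
  "drops D f \<longleftrightarrow> (\<forall>i. Suc i < length f \<longrightarrow> f ! Suc i + of_bool (Suc i \<in> D) \<le> f ! i)"

abbreviation drop_lists :: "nat set \<Rightarrow> nat \<Rightarrow> nat list set" where
  "drop_lists D n \<equiv> {f. length f = n \<and> drops D f}"

lemma drops_snoc: "drops D (f @ [x]) \<longleftrightarrow> drops D f \<and> (f \<noteq> [] \<longrightarrow> x + of_bool (length f \<in> D) \<le> last f)"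
proof -
  have "drops D (f @ [x]) \<longleftrightarrow> (\<forall>i. Suc i < length f \<or> Suc i = length f \<longrightarrow>
     (f @ [x]) ! Suc i + of_bool (Suc i \<in> D) \<le> (f @ [x]) ! i)"
    by (auto simp: drops_def less_Suc_eq)
  also have "\<dots> \<longleftrightarrow> drops D f \<and> (\<forall>i. Suc i = length f \<longrightarrow> x + of_bool (Suc i \<in> D) \<le> f ! i)"
    by (auto simp: drops_def nth_append)
  also have "(\<forall>i. Suc i = length f \<longrightarrow> x + of_bool (Suc i \<in> D) \<le> f ! i) \<longleftrightarrow>
    (f \<noteq> [] \<longrightarrow> x + of_bool (length f \<in> D) \<le> last f)"
    by (cases f rule: rev_cases) auto
  finally show ?thesis .
qed

lemma drops_map_Suc: "drops D (map Suc f) \<longleftrightarrow> drops D f"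
  by (auto simp: drops_def)

lemma drops_last_le: "drops D f \<Longrightarrow> x \<in> set f \<Longrightarrow> last f \<le> x"
proof (induction f rule: rev_induct)
  case (snoc y f)
  then show ?case by (cases "f = []") (auto simp: drops_snoc intro: order_trans)
qed simp

lemma fin_levels_sum_list: "fin_levels sum_list {f. length f = n \<and> P f}" for P :: "nat list \<Rightarrow> bool"
  unfolding fin_levels_def
proof
  fix s
  have "{f. f \<in> {f. length f = n \<and> P f} \<and> sum_list f = s} \<subseteq> {f. set f \<subseteq> {..s} \<and> length f = n}"
    by (auto intro: member_le_sum_list)
  then show "finite {f. f \<in> {f. length f = n \<and> P f} \<and> sum_list f = s}"
    by (rule finite_subset) (auto intro: finite_lists_length_eq)
qed

text \<open>The q-Pochhammer symbol \<open>(q; q)_n\<close> at q = \<open>fps_X\<close>, the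
  denominator for partitions with at most \<open>n\<close> parts.\<close>

definition qfact :: "nat \<Rightarrow> 'b::comm_ring_1 fps" where
  "qfact n = (\<Prod>i=1..n. 1 - fps_X ^ i)"

lemma qfact_0 [simp]: "qfact 0 = 1" and qfact_Suc: "qfact (Suc n) = qfact n * (1 - fps_X ^ Suc n)"
  by (simp_all add: qfact_def)

lemma gf_map_Suc:
  "gf t sum_list (\<lambda>_. 0) (map Suc ` drop_lists D n) = fps_X ^ n * gf t sum_list (\<lambda>_. 0) (drop_lists D n)"
proof -
  have "sum_list (map Suc f) = sum_list f + length f" for f by (induction f) auto
  then have "gf t sum_list (\<lambda>_. 0) (map Suc ` drop_lists D n) =
    fps_const (t ^ 0) * fps_X ^ n * gf t sum_list (\<lambda>_. 0) (drop_lists D n)"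
    by (intro gf_bij[where h = "map Suc"]) (auto simp: bij_betw_def inj_on_def inj_map_eq_map)
  then show ?thesis by simp
qed

text \<open>The last entry of a weakly decreasing list is its least, so if it is positive then 1 can
  be subtracted throughout.\<close>

lemma map_Suc_drop_lists:
  "map Suc ` drop_lists D n = {f. length f = n \<and> drops D f \<and> (f \<noteq> [] \<longrightarrow> 0 < last f)}"
proof (intro equalityI subsetI)
  fix f assume f: "f \<in> {f. length f = n \<and> drops D f \<and> (f \<noteq> [] \<longrightarrow> 0 < last f)}"
  have "0 < x" if "x \<in> set f" for x using f drops_last_le[of D f x] that by (cases "f = []") auto
  then have eq: "map Suc (map (\<lambda>x. x - 1) f) = f" by (auto intro!: map_idI)
  have "drops D (map (\<lambda>x. x - 1) f)" unfolding drops_map_Suc[symmetric, of D "map _ f"] eq using f by simp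
  then show "f \<in> map Suc ` drop_lists D n" 
    using f eq by (intro image_eqI[where x = "map (\<lambda>x. x - 1) f"]) simp_all
next
  fix f assume "f \<in> map Suc ` drop_lists D n"
  then obtain h where "f = map Suc h" "length h = n" "drops D h" by blast
  then show "f \<in> {f. length f = n \<and> drops D f \<and> (f \<noteq> [] \<longrightarrow> 0 < last f)}"
    by (cases "h = []") (simp_all add: drops_map_Suc last_map)
qed

text \<open>Either 1 can be subtracted from all entries, which accounts for the factor
  \<open>1 - fps_X ^ Suc n\<close>, or the list ends in 0. In that case the first \<open>n\<close>
  entries form a shorter list; if \<open>n \<in> D\<close> they must stay positive, which costs one
  unit for each of them.\<close>

lemma gf_drop_lists:
  "gf t sum_list (\<lambda>_. 0) (drop_lists D n) * qfact n = fps_X ^ (\<Sum> (D \<inter> {1..n - 1}))"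
proof (induction n)
  case 0
  have "drop_lists D 0 = {[]}" by (auto simp: drops_def)
  moreover have "fps_nth (gf t sum_list (\<lambda>_. 0) {[]}) s = fps_nth 1 s" for s
  proof (cases s)
    case 0
    then have e: "{x :: nat list. x \<in> {[]} \<and> sum_list x = s} = {[]}" by auto
    show ?thesis unfolding gf_def fps_nth_Abs_fps e by (simp add: 0)
  next
    case (Suc r)
    then have e: "{x :: nat list. x \<in> {[]} \<and> sum_list x = s} = {}" by auto
    show ?thesis unfolding gf_def fps_nth_Abs_fps e by (simp add: Suc)
  qed
  ultimately show ?case by (simp add: fps_eq_iff)
next
  case (Suc n)
  let ?G = "\<lambda>n. gf t sum_list (\<lambda>_. 0) (drop_lists D n)"
  let ?Z = "{f. length f = Suc n \<and> drops D f \<and> last f = 0}"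
  let ?c = "n * of_bool (n \<in> D)"
  have "drop_lists D (Suc n) = map Suc ` drop_lists D (Suc n) \<union> ?Z"
    unfolding map_Suc_drop_lists by auto
  then have "?G (Suc n) = gf t sum_list (\<lambda>_. 0) (map Suc ` drop_lists D (Suc n) \<union> ?Z)" by simp
  also have "\<dots> = gf t sum_list (\<lambda>_. 0) (map Suc ` drop_lists D (Suc n)) + gf t sum_list (\<lambda>_. 0) ?Z"
    by (rule gf_Un) (auto simp: map_Suc_drop_lists fin_levels_sum_list)
  also have "gf t sum_list (\<lambda>_. 0) ?Z = fps_X ^ ?c * ?G n"
  proof -
    let ?S = "if n \<in> D then map Suc ` drop_lists D n else drop_lists D n"
    have "bij_betw (\<lambda>f. f @ [0]) ?S ?Z"
    proof (rule bij_betwI[where g = butlast])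
      have S: "f @ [0] \<in> ?Z \<longleftrightarrow> f \<in> ?S" for f
        unfolding map_Suc_drop_lists by (auto simp: drops_snoc)
      show "(\<lambda>f. f @ [0]) \<in> ?S \<rightarrow> ?Z" using S by blast
      have Z: "butlast f @ [0] = f" if "f \<in> ?Z" for f
        using that by (cases f rule: rev_cases) auto
      then show "butlast f @ [0] = f" if "f \<in> ?Z" for f using that by blast
      show "butlast \<in> ?Z \<rightarrow> ?S"
      proof
        fix f assume f: "f \<in> ?Z"
        from S[of "butlast f", unfolded Z[OF f]] f show "butlast f \<in> ?S" by blast
      qed
    qed simp
    then have "gf t sum_list (\<lambda>_. 0) ?Z = fps_const (t ^ 0) * fps_X ^ 0 * gf t sum_list (\<lambda>_. 0) ?S"
      by (intro gf_bij[where h = "\<lambda>f. f @ [0]"]) auto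
    then show ?thesis by (simp add: gf_map_Suc)
  qed
  finally have "?G (Suc n) = fps_X ^ Suc n * ?G (Suc n) + fps_X ^ ?c * ?G n"
    unfolding gf_map_Suc .
  moreover have "a * (1 - b) = c" if "a = b * a + c" for a b c :: "'a fps"
    using that by (metis add_diff_cancel_left' mult.commute mult.right_neutral right_diff_distrib)
  ultimately have rec: "?G (Suc n) * (1 - fps_X ^ Suc n) = fps_X ^ ?c * ?G n" by blast
  have "?G (Suc n) * qfact (Suc n) = ?G (Suc n) * (1 - fps_X ^ Suc n) * qfact n"
    by (simp only: qfact_Suc mult_ac)
  also have "\<dots> = fps_X ^ ?c * (?G n * qfact n)" unfolding rec by (simp add: mult_ac)
  also have "\<dots> = fps_X ^ (?c + \<Sum> (D \<inter> {1..n - 1}))" by (simp add: Suc.IH power_add)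
  also have "?c + \<Sum> (D \<inter> {1..n - 1}) = \<Sum> (D \<inter> {1..Suc n - 1})"
  proof (cases n)
    case (Suc k)
    have "D \<inter> {1..Suc k} = (if Suc k \<in> D then insert (Suc k) (D \<inter> {1..k}) else D \<inter> {1..k})"
      by (auto simp: le_Suc_eq)
    then show ?thesis using Suc by simp
  qed simp
  finally show ?case .
qed

section \<open>Fillings as multisets\<close>

text \<open>A weakly decreasing filling is determined by its multiset of letters; this recovers it
  as a function on positions from 1, the form that \<open>compatible\<close> takes.\<close>

definition desc :: "nat multiset \<Rightarrow> nat \<Rightarrow> nat" where
  "desc m i = rev (sorted_list_of_multiset m) ! (i - 1)"

definition mval :: "nat multiset \<Rightarrow> nat" where "mval m = (\<Sum>x\<in>#m. x div 2)"

lemma desc_anti: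
  assumes "size m = n" "i \<in> {1..n}" "j \<in> {1..n}" "i \<le> j"
  shows "desc m j \<le> desc m i"
proof -
  have len: "length (sorted_list_of_multiset m) = n"
    using assms(1) by (metis mset_sorted_list_of_multiset size_mset)
  have "sorted (sorted_list_of_multiset m)" by simp
  then show ?thesis unfolding desc_def
    using assms len by (subst (1 2) rev_nth) (auto intro!: sorted_nth_mono)
qed

lemma map_desc: "size m = n \<Longrightarrow> map (desc m) [1..<Suc n] = rev (sorted_list_of_multiset m)"
  by (rule nth_equalityI)
     (auto simp: desc_def simp flip: size_mset simp del: upt_Suc)

lemma image_mset_desc: "size m = n \<Longrightarrow> image_mset (desc m) (mset_set {1..n}) = m"
proof -
  assume "size m = n"
  then have "mset (map (desc m) [1..<Suc n]) = m" by (simp only: map_desc) simp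
  moreover have "mset_set {1..n} = mset [1..<Suc n]"
    by (metis atLeastLessThanSuc_atLeastAtMost mset_upt)
  ultimately show ?thesis by (simp del: upt_Suc)
qed

definition fillings :: "nat \<Rightarrow> (nat \<Rightarrow> nat) \<Rightarrow> nat multiset set" where
  "fillings n \<sigma> = {m. size m = n \<and> compatible n (desc m) \<sigma>}"

lemma exc_fillings:
  assumes "m \<in> fillings n \<sigma>"
  shows "exc n \<sigma> = size (filter_mset odd m)"
proof -
  have m: "size m = n" and c: "compatible n (desc m) \<sigma>" using assms by (auto simp: fillings_def)
  then have p: "\<sigma> permutes {1..n}" by (simp add: compatible_def)
  have "{i \<in> {1..n - 1}. \<sigma> i > i} = {i \<in> {1..n}. odd (desc m i)}"
  proof -
    have "{i \<in> {1..n - 1}. \<sigma> i > i} = {i \<in> {1..n}. \<sigma> i > i}"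
    proof -
      have "\<sigma> i \<le> n" if "i \<in> {1..n}" for i using permutes_in_image[OF p, of i] that by simp
      then show ?thesis by force
    qed
    then show ?thesis using c by (auto simp: compatible_def)
  qed
  then have "exc n \<sigma> = card {i \<in> {1..n}. odd (desc m i)}" by (simp add: exc_def)
  also have "\<dots> = size (filter_mset odd (image_mset (desc m) (mset_set {1..n})))"
    by (simp add: filter_mset_image_mset)
  finally show ?thesis using image_mset_desc[OF m] by simp
qed

text \<open>The bars are dictated by \<open>\<sigma>\<close>, so only the values are free. Passing
  from an unbarred to a barred letter without increase lowers the value, and between letters with
  equal bars a descent of \<open>\<sigma>\<close> forbids a tie, so the value drops again; these are
  the two cases of \<open>dex\<close>. In all other cases weakly decreasing values suffice.\<close>

lemma bij_fillings:
  assumes p: "\<sigma> permutes {1..n}"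
  shows "bij_betw (\<lambda>m. map (\<lambda>i. desc m i div 2) [1..<Suc n]) (fillings n \<sigma>) (drop_lists (dex n \<sigma>) n)"
    (is "bij_betw ?h _ _")
proof (rule bij_betwI')
  fix m m' assume m: "m \<in> fillings n \<sigma>" and m': "m' \<in> fillings n \<sigma>"
  have sz: "size m = n" "size m' = n" and c: "compatible n (desc m) \<sigma>" "compatible n (desc m') \<sigma>"
    using m m' by (auto simp: fillings_def)
  show "?h m = ?h m' \<longleftrightarrow> m = m'"
  proof
    assume eq: "?h m = ?h m'"
    have "desc m i = desc m' i" if i: "i \<in> {1..n}" for i
    proof -
      have "desc m i div 2 = desc m' i div 2" using eq i by (simp add: less_Suc_eq_le del: upt_Suc)
      moreover have "odd (desc m i) \<longleftrightarrow> odd (desc m' i)" using c i by (auto simp: compatible_def)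
      ultimately show ?thesis by presburger
    qed
    then have "image_mset (desc m) (mset_set {1..n}) = image_mset (desc m') (mset_set {1..n})"
      by (intro image_mset_cong) auto
    then show "m = m'" unfolding image_mset_desc[OF sz(1)] image_mset_desc[OF sz(2)] .
  qed simp
  show "?h m \<in> drop_lists (dex n \<sigma>) n"
  proof -
    have "desc m (Suc i) div 2 + of_bool (i \<in> dex n \<sigma>) \<le> desc m i div 2" if i: "1 \<le> i" "Suc i \<le> n" for i
    proof -
      have in_n: "i \<in> {1..n}" "Suc i \<in> {1..n}" using i by auto
      have le: "desc m (Suc i) \<le> desc m i" using desc_anti[OF sz(1) in_n] by simp
      have par: "odd (desc m i) \<longleftrightarrow> i < \<sigma> i" "odd (desc m (Suc i)) \<longleftrightarrow> Suc i < \<sigma> (Suc i)"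
        using c(1) in_n by (auto simp: compatible_def)
      have incr: "desc m i = desc m (Suc i) \<longrightarrow> \<sigma> i < \<sigma> (Suc i)"
        using c(1) in_n by (auto simp: compatible_def)
      show ?thesis
      proof (cases "i \<in> dex n \<sigma>")
        case True
        then have "(odd (desc m i) \<longleftrightarrow> odd (desc m (Suc i))) \<and> desc m i \<noteq> desc m (Suc i) \<or>
          even (desc m i) \<and> odd (desc m (Suc i))"
          using par incr by (auto simp: dex_def)
        then have "desc m (Suc i) div 2 < desc m i div 2" using le by presburger
        then show ?thesis by simp
      qed (use le in \<open>simp add: div_le_mono\<close>)
    qed
    then show ?thesis by (auto simp: drops_def simp del: upt_Suc)
  qed
next
  fix f assume "f \<in> drop_lists (dex n \<sigma>) n"
  then have len: "length f = n" and d: "drops (dex n \<sigma>) f" by auto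
  define g where "g i = 2 * f ! (i - 1) + of_bool (i < \<sigma> i)" for i
  have step: "g (Suc i) \<le> g i \<and> (g (Suc i) = g i \<longrightarrow> \<sigma> i < \<sigma> (Suc i))" if i: "1 \<le> i" "Suc i \<le> n" for i
  proof -
    have le: "f ! i + of_bool (i \<in> dex n \<sigma>) \<le> f ! (i - 1)"
      using d[unfolded drops_def, rule_format, of "i - 1"] i len by simp
    have ne: "\<sigma> i \<noteq> \<sigma> (Suc i)" using permutes_inj[OF p] by (metis inj_eq n_not_Suc_n)
    show ?thesis
    proof (cases "i \<in> dex n \<sigma>")
      case True
      then show ?thesis using le by (auto simp: g_def)
    next
      case False
      then show ?thesis using le i ne by (auto simp: g_def dex_def)
    qed
  qed
  have chain: "g j \<le> g i \<and> (g j = g i \<and> i < j \<longrightarrow> \<sigma> i < \<sigma> j)" if "1 \<le> i" "i \<le> j" "j \<le> n" for i j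
    using that(2,3)
  proof (induction j rule: dec_induct)
    case (step k)
    note st = \<open>\<And>i. 1 \<le> i \<Longrightarrow> Suc i \<le> n \<Longrightarrow> _ i\<close>
    show ?case using step st[of k] that(1)
      by (cases "i = k") auto
  qed simp
  define m where "m = mset (map g [1..<Suc n])"
  have sz: "size m = n" by (simp add: m_def del: upt_Suc)
  have "sorted (rev (map g [1..<Suc n]))"
    unfolding sorted_rev_iff_nth_mono using chain by (auto simp del: upt_Suc)
  then have "sorted_list_of_multiset m = rev (map g [1..<Suc n])"
    unfolding m_def by (metis mset_rev sorted_list_of_multiset_mset sort_key_id_if_sorted sorted_sort_id)
  then have dg: "desc m i = g i" if "i \<in> {1..n}" for i using that by (auto simp: desc_def simp del: upt_Suc)
  have "compatible n (desc m) \<sigma>"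
    unfolding compatible_def
  proof (intro conjI ballI impI)
    fix i j assume ij: "i \<in> {1..n}" "j \<in> {1..n}" "i < j \<and> desc m i = desc m j"
    then have "g j = g i" using dg by metis
    then show "\<sigma> i < \<sigma> j" using chain[of i j] ij by auto
  qed (use p dg in \<open>auto simp: g_def\<close>)
  then have "m \<in> fillings n \<sigma>" using sz by (simp add: fillings_def)
  moreover have "f = ?h m"
    by (rule nth_equalityI) (auto simp: len dg g_def simp del: upt_Suc)
  ultimately show "\<exists>m\<in>fillings n \<sigma>. f = ?h m" by blast
qed

lemma gf_fillings:
  assumes "\<sigma> permutes {1..n}"
  shows "gf t mval (\<lambda>_. exc n \<sigma>) (fillings n \<sigma>) * qfact n = fps_const (t ^ exc n \<sigma>) * fps_X ^ (\<Sum> (dex n \<sigma>))"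
proof -
  let ?h = "\<lambda>m. map (\<lambda>i. desc m i div 2) [1..<Suc n]"
  have "mval m = sum_list (?h m)" if "m \<in> fillings n \<sigma>" for m
  proof -
    have sz: "size m = n" using that by (simp add: fillings_def)
    have "mval m = (\<Sum>x\<in>#image_mset (desc m) (mset_set {1..n}). x div 2)"
      unfolding image_mset_desc[OF sz] mval_def ..
    also have "\<dots> = (\<Sum>i=1..n. desc m i div 2)"
      by (simp add: image_mset.compositionality comp_def sum_unfold_sum_mset)
    also have "\<dots> = sum_list (?h m)"
      by (simp add: interv_sum_list_conv_sum_set_nat atLeastLessThanSuc_atLeastAtMost del: upt_Suc)
    finally show ?thesis .
  qed
  then have "gf t sum_list (\<lambda>_. 0) (drop_lists (dex n \<sigma>) n) =
      fps_const (t ^ 0) * fps_X ^ 0 * gf t mval (\<lambda>_. 0) (fillings n \<sigma>)"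
    by (intro gf_bij[OF bij_fillings[OF assms]]) auto
  moreover have "gf t mval (\<lambda>_. exc n \<sigma>) (fillings n \<sigma>) = fps_const (t ^ exc n \<sigma>) * gf t mval (\<lambda>_. 0) (fillings n \<sigma>)"
    by (rule fps_ext) (simp add: gf_def mult.commute)
  moreover have "dex n \<sigma> \<inter> {1..n - 1} = dex n \<sigma>" by (auto simp: dex_def)
  ultimately show ?thesis using gf_drop_lists[where t = t and D = "dex n \<sigma>" and n = n] by (simp add: mult.assoc)
qed

text \<open>Pairs of \<open>\<sigma>\<close> and \<open>m\<close> are counted in the other order:
  for fixed \<open>m\<close> there are as many compatible permutations as banners with content
  \<open>m\<close>, and both weights depend on \<open>m\<close> only.\<close>

lemma sum_gf_fillings:
  "(\<Sum>\<sigma> | \<sigma> permutes {1..n}. gf t mval (\<lambda>_. exc n \<sigma>) (fillings n \<sigma>)) = banner_gf t n"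
proof (rule fps_ext)
  fix s
  define Ms where "Ms = {m. size m = n \<and> mval m = s}"
  have mval_mset: "mval (mset w) = val w" for w by (simp add: mval_def val_def sum_mset_sum_list[symmetric])
  have bars_mset: "size (filter_mset odd (mset w)) = bars w" for w by (simp add: bars_def flip: mset_filter)
  have "Ms = mset ` {w. w \<in> {w. length w = n \<and> True} \<and> val w = s}"
  proof (intro equalityI subsetI)
    fix m assume m: "m \<in> Ms"
    obtain w where "mset w = m" using ex_mset by blast
    then show "m \<in> mset ` {w. w \<in> {w. length w = n \<and> True} \<and> val w = s}"
      using m by (auto simp: Ms_def mval_mset)
  qed (auto simp: Ms_def mval_mset)
  then have finMs: "finite Ms" using fin_levels_length[of n "\<lambda>_. True"] by (simp add: fin_levels_def)
  have "fps_nth (\<Sum>\<sigma> | \<sigma> permutes {1..n}. gf t mval (\<lambda>_. exc n \<sigma>) (fillings n \<sigma>)) s =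
    (\<Sum>\<sigma> | \<sigma> permutes {1..n}. \<Sum>m | m \<in> Ms \<and> compatible n (desc m) \<sigma>. t ^ size (filter_mset odd m))"
    unfolding fps_sum_nth gf_def fps_nth_Abs_fps
  proof (rule sum.cong[OF refl])
    fix \<sigma>
    have "{m. m \<in> fillings n \<sigma> \<and> mval m = s} = {m. m \<in> Ms \<and> compatible n (desc m) \<sigma>}"
      by (auto simp: Ms_def fillings_def)
    then show "(\<Sum>m | m \<in> fillings n \<sigma> \<and> mval m = s. t ^ exc n \<sigma>) =
      (\<Sum>m | m \<in> Ms \<and> compatible n (desc m) \<sigma>. t ^ size (filter_mset odd m))"
    proof (rule sum.cong)
      fix m assume "m \<in> {m. m \<in> Ms \<and> compatible n (desc m) \<sigma>}"
      then have "m \<in> fillings n \<sigma>" by (simp add: Ms_def fillings_def)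
      then show "t ^ exc n \<sigma> = t ^ size (filter_mset odd m)" by (simp add: exc_fillings)
    qed
  qed
  also have "\<dots> = (\<Sum>m\<in>Ms. \<Sum>\<sigma> | \<sigma> \<in> {\<sigma>. \<sigma> permutes {1..n}} \<and> compatible n (desc m) \<sigma>. t ^ size (filter_mset odd m))"
    by (rule sum.swap_restrict) (auto simp: finMs finite_permutations)
  also have "\<dots> = (\<Sum>m\<in>Ms. \<Sum>w | mset w = m \<and> banner w. t ^ bars w)"
  proof (rule sum.cong[OF refl])
    fix m assume "m \<in> Ms"
    then have sz: "size m = n" by (simp add: Ms_def)
    have "card {\<sigma>. compatible n (desc m) \<sigma>} = card {w. mset w = m \<and> banner w}"
      using card_compatible[OF desc_anti[OF sz] image_mset_desc[OF sz, symmetric]] card_pred_lists_banners by simp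
    moreover have "{\<sigma>. \<sigma> \<in> {\<sigma>. \<sigma> permutes {1..n}} \<and> compatible n (desc m) \<sigma>} = {\<sigma>. compatible n (desc m) \<sigma>}"
      by (auto simp: compatible_def)
    moreover have "(\<Sum>w | mset w = m \<and> banner w. t ^ bars w) = (\<Sum>w | mset w = m \<and> banner w. t ^ size (filter_mset odd m))"
      by (intro sum.cong) (auto simp: bars_mset)
    ultimately show "(\<Sum>\<sigma> | \<sigma> \<in> {\<sigma>. \<sigma> permutes {1..n}} \<and> compatible n (desc m) \<sigma>. t ^ size (filter_mset odd m)) =
      (\<Sum>w | mset w = m \<and> banner w. t ^ bars w)" by simp
  qed
  also have "\<dots> = (\<Sum>w\<in>(\<Union>m\<in>Ms. {w. mset w = m \<and> banner w}). t ^ bars w)"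
    by (subst sum.UNION_disjoint) (auto simp: finMs finite_mset_eq)
  also have "(\<Union>m\<in>Ms. {w. mset w = m \<and> banner w}) = {w. w \<in> banners n \<and> val w = s}"
    by (auto simp: Ms_def banners_def mval_mset)
  finally show "fps_nth (\<Sum>\<sigma> | \<sigma> permutes {1..n}. gf t mval (\<lambda>_. exc n \<sigma>) (fillings n \<sigma>)) s =
    fps_nth (banner_gf t n) s" by (simp add: gf_def)
qed

lemma dex_exc_gf:
  "(\<Sum>\<sigma> | \<sigma> permutes {1..n}. fps_const (t ^ exc n \<sigma>) * fps_X ^ (\<Sum> (dex n \<sigma>))) = banner_gf t n * qfact n"
proof -
  have "banner_gf t n * qfact n = (\<Sum>\<sigma> | \<sigma> permutes {1..n}. gf t mval (\<lambda>_. exc n \<sigma>) (fillings n \<sigma>) * qfact n)"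
    by (simp add: sum_gf_fillings[symmetric] sum_distrib_right)
  also have "\<dots> = (\<Sum>\<sigma> | \<sigma> permutes {1..n}. fps_const (t ^ exc n \<sigma>) * fps_X ^ (\<Sum> (dex n \<sigma>)))"
    by (intro sum.cong) (auto simp: gf_fillings)
  finally show ?thesis by simp
qed

section \<open>The pair (ai, des)\<close>

text \<open>Stated by positions from 0 in an arbitrary list, so that it also applies to the parts of
  a word cut at its least letter.\<close>

definition adm :: "nat list \<Rightarrow> nat \<Rightarrow> nat \<Rightarrow> bool" where
  "adm xs i j \<longleftrightarrow> xs ! j < xs ! i \<and>
     (Suc j < length xs \<and> xs ! j < xs ! Suc j \<or> (\<exists>k. i < k \<and> k < j \<and> xs ! k < xs ! j))"

definition list_ai :: "nat list \<Rightarrow> nat" where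
  "list_ai xs = (\<Sum>j<length xs. \<Sum>i<j. of_bool (adm xs i j))"

definition list_des :: "nat list \<Rightarrow> nat" where
  "list_des xs = (\<Sum>i<length xs - 1. of_bool (xs ! Suc i < xs ! i))"

definition inv_between :: "nat set \<Rightarrow> nat set \<Rightarrow> nat" where
  "inv_between A B = card {(a, b). a \<in> A \<and> b \<in> B \<and> b < a}"

lemma sum_lessThan_split_at:
  fixes f :: "nat \<Rightarrow> nat"
  shows "(\<Sum>i<Suc a + b. f i) = (\<Sum>i<a. f i) + f a + (\<Sum>i<b. f (Suc a + i))"
  by (induction b) auto

text \<open>To the letters of \<open>L\<close> the smaller \<open>x\<close> behind them acts like
  the end of the word. An inversion ending in \<open>x\<close> has no smaller letter inside, so it
  is admissible exactly when a letter follows \<open>x\<close>. An inversion from \<open>L\<close>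
  to \<open>R\<close> is always admissible, with \<open>x\<close> as the witness in between. No
  inversion starts at \<open>x\<close>.\<close>

lemma list_ai_split:
  assumes d: "distinct (L @ x # R)" and x: "\<forall>y\<in>set L \<union> set R. x < y"
  shows "list_ai (L @ x # R) =
    list_ai L + list_ai R + inv_between (set L) (set R) + (if R = [] then 0 else length L)"
proof -
  let ?w = "L @ x # R" and ?a = "length L" and ?b = "length R"
  have nL: "?w ! i = L ! i" if "i < ?a" for i using that by (simp add: nth_append)
  have nx: "?w ! ?a = x" by simp
  have nR: "?w ! (Suc ?a + i) = R ! i" for i by (simp add: nth_append)
  have Lx: "x < L ! i" if "i < ?a" for i using x that by simp
  have Rx: "x < R ! i" if "i < ?b" for i using x that by simp
  have LL: "adm ?w i j \<longleftrightarrow> adm L i j" if "i < j" "j < ?a" for i j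
  proof -
    have "(Suc j < length ?w \<and> ?w ! j < ?w ! Suc j) \<longleftrightarrow> (Suc j < ?a \<and> L ! j < L ! Suc j)"
    proof (cases "Suc j < ?a")
      case False
      then have "Suc j = ?a" using that by simp
      then show ?thesis using nx nL[of j] Lx[of j] that by simp
    qed (use nL in simp)
    then show ?thesis unfolding adm_def using that nL by auto
  qed
  have Lmin: "adm ?w i ?a \<longleftrightarrow> R \<noteq> []" if "i < ?a" for i
  proof -
    have "\<not> (\<exists>k. i < k \<and> k < ?a \<and> ?w ! k < ?w ! ?a)" 
    proof (intro notI, elim exE conjE)
      fix k assume "k < ?a" "?w ! k < ?w ! ?a"
      then show False using nL[of k] Lx[of k] nx by simp
    qed
    moreover have "Suc ?a < length ?w \<and> ?w ! ?a < ?w ! Suc ?a \<longleftrightarrow> R \<noteq> []"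
      using nR[of 0] Rx[of 0] by auto
    moreover have "?w ! ?a < ?w ! i" using Lx[OF that] nL[OF that] by simp
    ultimately show ?thesis unfolding adm_def by blast
  qed
  have LR: "adm ?w i (Suc ?a + j) \<longleftrightarrow> R ! j < L ! i" if "i < ?a" "j < ?b" for i j
  proof -
    have "\<exists>k. i < k \<and> k < Suc ?a + j \<and> ?w ! k < ?w ! (Suc ?a + j)"
      using that Rx[of j] nR[of j] nx by (intro exI[of _ ?a]) simp
    then show ?thesis unfolding adm_def using nL[OF that(1)] nR[of j] by simp
  qed
  have xR: "\<not> adm ?w ?a (Suc ?a + j)" if "j < ?b" for j
    unfolding adm_def using Rx[OF that] nR[of j] by simp
  have RR: "adm ?w (Suc ?a + i) (Suc ?a + j) \<longleftrightarrow> adm R i j" if "i < j" "j < ?b" for i j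
  proof -
    have "(\<exists>k. Suc ?a + i < k \<and> k < Suc ?a + j \<and> ?w ! k < ?w ! (Suc ?a + j)) \<longleftrightarrow>
      (\<exists>k. i < k \<and> k < j \<and> R ! k < R ! j)" (is "?P \<longleftrightarrow> ?Q")
    proof
      assume ?P
      then obtain k where k: "Suc ?a + i < k" "k < Suc ?a + j" "?w ! k < ?w ! (Suc ?a + j)" by blast
      define k' where "k' = k - Suc ?a"
      have "k = Suc ?a + k'" using k by (simp add: k'_def)
      then show ?Q using k nR[of k'] nR[of j] by auto
    next
      assume ?Q
      then obtain k where k: "i < k" "k < j" "R ! k < R ! j" by blast
      then show ?P using nR[of k] nR[of j] by (intro exI[of _ "Suc ?a + k"]) simp
    qed
    moreover have "(Suc (Suc ?a + j) < length ?w \<and> ?w ! (Suc ?a + j) < ?w ! Suc (Suc ?a + j)) \<longleftrightarrow>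
      (Suc j < ?b \<and> R ! j < R ! Suc j)" using nR[of j] nR[of "Suc j"] by simp
    ultimately show ?thesis unfolding adm_def using nR[of i] nR[of j] by simp
  qed
  have inv: "(\<Sum>j<?b. \<Sum>i<?a. of_bool (R ! j < L ! i)) = inv_between (set L) (set R)"
  proof -
    let ?f = "\<lambda>(j, i). (L ! i, R ! j)"
    let ?S = "{(j, i). j < ?b \<and> i < ?a \<and> R ! j < L ! i}"
    have "(\<Sum>j<?b. \<Sum>i<?a. of_bool (R ! j < L ! i)) =
      (\<Sum>(j, i)\<in>{..<?b} \<times> {..<?a}. of_bool (R ! j < L ! i))"
      by (rule sum.cartesian_product)
    also have "\<dots> = (\<Sum>p\<in>{p \<in> {..<?b} \<times> {..<?a}. R ! fst p < L ! snd p}. 1)"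
      by (subst sum.inter_filter) (auto simp: case_prod_unfold of_bool_def)
    also have "{p \<in> {..<?b} \<times> {..<?a}. R ! fst p < L ! snd p} = ?S" by auto
    also have "(\<Sum>p\<in>?S. 1) = card ?S" by simp
    also have "card ?S = card (?f ` ?S)"
      using d by (intro card_image[symmetric] inj_onI) (auto simp: nth_eq_iff_index_eq)
    also have "?f ` ?S = {(a, b). a \<in> set L \<and> b \<in> set R \<and> b < a}"
      by (auto simp: in_set_conv_nth image_iff)
    finally show ?thesis by (simp add: inv_between_def)
  qed
  have "list_ai ?w = (\<Sum>j<Suc ?a + ?b. \<Sum>i<j. of_bool (adm ?w i j))" by (simp add: list_ai_def)
  also have "\<dots> = (\<Sum>j<?a. \<Sum>i<j. of_bool (adm ?w i j)) + (\<Sum>i<?a. of_bool (adm ?w i ?a)) +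
    (\<Sum>j<?b. \<Sum>i<Suc ?a + j. of_bool (adm ?w i (Suc ?a + j)))"
    by (rule sum_lessThan_split_at)
  also have "(\<Sum>j<?a. \<Sum>i<j. of_bool (adm ?w i j)) = list_ai L"
    unfolding list_ai_def by (intro sum.cong) (auto simp: LL)
  also have "(\<Sum>i<?a. of_bool (adm ?w i ?a)) = (if R = [] then 0 else ?a)"
    using Lmin by simp
  also have "(\<Sum>j<?b. \<Sum>i<Suc ?a + j. of_bool (adm ?w i (Suc ?a + j)) :: nat) =
    (\<Sum>j<?b. (\<Sum>i<?a. of_bool (R ! j < L ! i)) + (\<Sum>i<j. of_bool (adm R i j)))"
  proof (rule sum.cong[OF refl])
    fix j assume "j \<in> {..<?b}"
    then have j: "j < ?b" by simp
    have "(\<Sum>i<Suc ?a + j. of_bool (adm ?w i (Suc ?a + j)) :: nat) =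
      (\<Sum>i<?a. of_bool (adm ?w i (Suc ?a + j))) + of_bool (adm ?w ?a (Suc ?a + j)) +
      (\<Sum>i<j. of_bool (adm ?w (Suc ?a + i) (Suc ?a + j)))"
      by (rule sum_lessThan_split_at)
    also have "(\<Sum>i<?a. of_bool (adm ?w i (Suc ?a + j)) :: nat) = (\<Sum>i<?a. of_bool (R ! j < L ! i))"
      using LR[OF _ j] by (intro sum.cong refl) simp
    also have "(\<Sum>i<j. of_bool (adm ?w (Suc ?a + i) (Suc ?a + j)) :: nat) = (\<Sum>i<j. of_bool (adm R i j))"
      using RR[OF _ j] by (intro sum.cong refl) simp
    finally show "(\<Sum>i<Suc ?a + j. of_bool (adm ?w i (Suc ?a + j)) :: nat) =
      (\<Sum>i<?a. of_bool (R ! j < L ! i)) + (\<Sum>i<j. of_bool (adm R i j))"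
      using xR[OF j] by (simp only: of_bool_eq add_0_right)
  qed
  also have "\<dots> = inv_between (set L) (set R) + list_ai R"
    unfolding sum.distrib inv list_ai_def ..
  finally show ?thesis by simp
qed

lemma list_des_append:
  assumes "v \<noteq> []" "w \<noteq> []"
  shows "list_des (v @ w) = list_des v + of_bool (hd w < last v) + list_des w"
proof -
  obtain a where a: "length v = Suc a" using assms(1) by (cases v) auto
  obtain b where b: "length w = Suc b" using assms(2) by (cases w) auto
  have "list_des (v @ w) = (\<Sum>i<Suc a + b. of_bool ((v @ w) ! Suc i < (v @ w) ! i))"
    by (simp add: list_des_def a b)
  also have "\<dots> = (\<Sum>i<a. of_bool ((v @ w) ! Suc i < (v @ w) ! i)) + of_bool ((v @ w) ! Suc a < (v @ w) ! a) +
    (\<Sum>i<b. of_bool ((v @ w) ! Suc (Suc a + i) < (v @ w) ! (Suc a + i)))"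
    by (rule sum_lessThan_split_at)
  also have "(\<Sum>i<a. of_bool ((v @ w) ! Suc i < (v @ w) ! i)) = list_des v"
    unfolding list_des_def a by (intro sum.cong) (auto simp: nth_append a)
  also have "(v @ w) ! Suc a = hd w" using assms a by (simp add: nth_append hd_conv_nth)
  also have "(v @ w) ! a = last v" using assms a by (simp add: nth_append last_conv_nth)
  also have "(\<Sum>i<b. of_bool ((v @ w) ! Suc (Suc a + i) < (v @ w) ! (Suc a + i))) = list_des w"
    unfolding list_des_def b by (intro sum.cong) (auto simp: nth_append a)
  finally show ?thesis .
qed

lemma list_des_split:
  assumes "\<forall>y\<in>set L \<union> set R. x < y"
  shows "list_des (L @ x # R) = list_des L + list_des R + of_bool (L \<noteq> [])"
proof -
  have "list_des (x # R) = list_des R"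
  proof (cases "R = []")
    case False
    then have "\<not> hd R < x" using assms by (metis UnI2 hd_in_set not_less_iff_gr_or_eq)
    then show ?thesis using list_des_append[of "[x]" R] False by (simp add: list_des_def)
  qed (simp add: list_des_def)
  moreover have "list_des (L @ x # R) = list_des L + 1 + list_des (x # R)" if "L \<noteq> []"
    using list_des_append[of L "x # R"] that assms by simp
  ultimately show ?thesis by (cases "L = []") (auto simp: list_des_def)
qed

lemma sum_permutations_of_set_split:
  fixes F :: "nat list \<Rightarrow> 'c::comm_monoid_add"
  assumes "finite S" "x \<notin> S"
  shows "(\<Sum>w\<in>permutations_of_set (insert x S). F w) =
    (\<Sum>K\<in>Pow S. \<Sum>L\<in>permutations_of_set K. \<Sum>R\<in>permutations_of_set (S - K). F (L @ x # R))"
proof -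
  let ?I = "Sigma (Pow S) (\<lambda>K. permutations_of_set K \<times> permutations_of_set (S - K))"
  let ?h = "\<lambda>(K, L, R). L @ x # R"
  have takeWhile_neq: "takeWhile (\<lambda>y. y \<noteq> x) (L @ x # R) = L" if "x \<notin> set L" for L R
    using that by (induction L) auto
  have "bij_betw ?h ?I (permutations_of_set (insert x S))"
  proof (rule bij_betw_imageI)
    show "inj_on ?h ?I"
    proof (rule inj_onI)
      fix p p' assume "p \<in> ?I" "p' \<in> ?I" and eq: "?h p = ?h p'"
      then obtain K L R K' L' R' where p: "p = (K, L, R)" "p' = (K', L', R')" "K \<subseteq> S" "K' \<subseteq> S"
        "set L = K" "set L' = K'" "set R = S - K" "set R' = S - K'"
        by (auto simp: permutations_of_set_def)
      have "x \<notin> set L" "x \<notin> set L'" using p assms by auto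
      moreover have "L @ x # R = L' @ x # R'" using eq p by simp
      ultimately have "L = L'" using takeWhile_neq[of L R] takeWhile_neq[of L' R'] by simp
      then have "L = L' \<and> R = R'" using \<open>L @ x # R = L' @ x # R'\<close> by simp
      then show "p = p'" using p by simp
    qed
    show "?h ` ?I = permutations_of_set (insert x S)"
    proof (intro equalityI subsetI)
      fix w assume "w \<in> permutations_of_set (insert x S)"
      then have w: "set w = insert x S" "distinct w" by (auto simp: permutations_of_set_def)
      then obtain L R where LR: "w = L @ x # R" by (metis insertI1 split_list)
      then have "(set L, L, R) \<in> ?I" using w assms by (auto simp: permutations_of_set_def)
      then show "w \<in> ?h ` ?I" by (rule rev_image_eqI) (simp add: LR)
    qed (use assms in \<open>auto simp: permutations_of_set_def\<close>)
  qed
  then have "(\<Sum>w\<in>permutations_of_set (insert x S). F w) = (\<Sum>p\<in>?I. F (?h p))"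
    by (rule sum.reindex_bij_betw[symmetric])
  also have "\<dots> = (\<Sum>K\<in>Pow S. \<Sum>p\<in>permutations_of_set K \<times> permutations_of_set (S - K). F (?h (K, p)))"
    using assms by (subst sum.Sigma) (auto simp: case_prod_unfold)
  also have "\<dots> = (\<Sum>K\<in>Pow S. \<Sum>L\<in>permutations_of_set K. \<Sum>R\<in>permutations_of_set (S - K). F (L @ x # R))"
    by (intro sum.cong refl) (simp add: sum.cartesian_product case_prod_unfold)
  finally show ?thesis .
qed

section \<open>Inversions between complementary subsets\<close>

lemma inv_between_insert_left:
  "\<forall>b\<in>B. x < b \<Longrightarrow> inv_between (insert x A) B = inv_between A B"
  unfolding inv_between_def by (intro arg_cong[where f = card]) auto

lemma inv_between_insert_right:
  assumes "finite A" "finite B" "\<forall>a\<in>A. x < a" "x \<notin> B"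
  shows "inv_between A (insert x B) = inv_between A B + card A"
proof -
  let ?S = "{(a, b). a \<in> A \<and> b \<in> B \<and> b < a}"
  have "{(a, b). a \<in> A \<and> b \<in> insert x B \<and> b < a} = ?S \<union> (\<lambda>a. (a, x)) ` A"
    using assms by auto
  moreover have "card (?S \<union> (\<lambda>a. (a, x)) ` A) = card ?S + card ((\<lambda>a. (a, x)) ` A)"
  proof (rule card_Un_disjoint)
    show "finite ?S" by (rule finite_subset[of _ "A \<times> B"]) (use assms in auto)
  qed (use assms in auto)
  ultimately show ?thesis by (simp add: inv_between_def card_image inj_on_def)
qed

text \<open>The sum is the q-binomial coefficient, written without division. The induction inserts a
  new least element \<open>x\<close>, which adds \<open>k\<close> inversions if it lies outside
  \<open>K\<close> and none if inside; this is the q-Pascal rule.\<close>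

lemma sum_inv_between:
  assumes "finite S" "k \<le> card S"
  shows "(\<Sum>K | K \<subseteq> S \<and> card K = k. fps_X ^ inv_between K (S - K)) * qfact k * qfact (card S - k) =
    (qfact (card S) :: 'b::comm_ring_1 fps)"
  using assms
proof (induction S arbitrary: k rule: finite_linorder_min_induct)
  case empty
  have "{K :: nat set. K = {} \<and> card K = 0} = {{}}" by auto
  then show ?case using empty by (simp add: inv_between_def)
next
  case (insert x S)
  let ?G = "\<lambda>S k. \<Sum>K | K \<subseteq> S \<and> card K = k. fps_X ^ inv_between K (S - K) :: 'b fps"
  let ?X = "fps_X :: 'b fps"
  have xS: "x \<notin> S" and cS: "card (insert x S) = Suc (card S)" using insert by auto
  have A: "(\<Sum>K | K \<subseteq> insert x S \<and> card K = k \<and> x \<notin> K. ?X ^ inv_between K (insert x S - K)) = ?X ^ k * ?G S k"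
  proof -
    have "{K. K \<subseteq> insert x S \<and> card K = k \<and> x \<notin> K} = {K. K \<subseteq> S \<and> card K = k}" using xS by auto
    moreover have "inv_between K (insert x S - K) = inv_between K (S - K) + card K" if "K \<subseteq> S" for K
    proof -
      have "insert x S - K = insert x (S - K)" using that xS by auto
      then show ?thesis using that insert.hyps xS
        by (auto intro!: inv_between_insert_right intro: finite_subset)
    qed
    ultimately show ?thesis by (simp add: power_add sum_distrib_left mult.commute)
  qed
  have B: "(\<Sum>K | K \<subseteq> insert x S \<and> card K = Suc j \<and> x \<in> K. ?X ^ inv_between K (insert x S - K)) = ?G S j" for j
  proof -
    have "bij_betw (insert x) {K. K \<subseteq> S \<and> card K = j} {K. K \<subseteq> insert x S \<and> card K = Suc j \<and> x \<in> K}"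
    proof (rule bij_betwI[where g = "\<lambda>K. K - {x}"])
      show "insert x \<in> {K. K \<subseteq> S \<and> card K = j} \<rightarrow> {K. K \<subseteq> insert x S \<and> card K = Suc j \<and> x \<in> K}"
      proof
        fix K assume "K \<in> {K. K \<subseteq> S \<and> card K = j}"
        moreover from this have "finite K" "x \<notin> K" using insert.hyps(1) xS by (auto intro: finite_subset)
        ultimately show "insert x K \<in> {K. K \<subseteq> insert x S \<and> card K = Suc j \<and> x \<in> K}" by auto
      qed
    qed (use xS in auto)
    then have "(\<Sum>K | K \<subseteq> insert x S \<and> card K = Suc j \<and> x \<in> K. ?X ^ inv_between K (insert x S - K)) =
      (\<Sum>K | K \<subseteq> S \<and> card K = j. ?X ^ inv_between (insert x K) (insert x S - insert x K))"
      by (rule sum.reindex_bij_betw[symmetric])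
    also have "\<dots> = ?G S j"
    proof (rule sum.cong[OF refl])
      fix K assume K: "K \<in> {K. K \<subseteq> S \<and> card K = j}"
      have "insert x S - insert x K = S - K" using xS by auto
      then show "?X ^ inv_between (insert x K) (insert x S - insert x K) = ?X ^ inv_between K (S - K)"
        using insert.hyps by (simp add: inv_between_insert_left)
    qed
    finally show ?thesis .
  qed
  have split: "?G (insert x S) k =
    (\<Sum>K | K \<subseteq> insert x S \<and> card K = k \<and> x \<notin> K. ?X ^ inv_between K (insert x S - K)) +
    (\<Sum>K | K \<subseteq> insert x S \<and> card K = k \<and> x \<in> K. ?X ^ inv_between K (insert x S - K))"
  proof -
    have "{K. K \<subseteq> insert x S \<and> card K = k} = {K. K \<subseteq> insert x S \<and> card K = k \<and> x \<notin> K} \<union>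
      {K. K \<subseteq> insert x S \<and> card K = k \<and> x \<in> K}" by auto
    moreover have "finite {K. K \<subseteq> insert x S \<and> P K}" for P
      by (rule finite_subset[of _ "Pow (insert x S)"]) (use insert.hyps in auto)
    ultimately show ?thesis by (simp only:) (rule sum.union_disjoint, auto)
  qed
  have zero: "?G S k = 0" if "card S < k"
  proof -
    have "{K. K \<subseteq> S \<and> card K = k} = {}" using that insert.hyps(1) by (auto dest: card_mono)
    then show ?thesis by (simp only:) simp
  qed
  show ?case
  proof (cases k)
    case 0
    have "{K. K \<subseteq> insert x S \<and> card K = 0} = {{}}"
      using insert.hyps(1) by (auto dest: finite_subset)
    then have "?G (insert x S) k = (\<Sum>K\<in>{{}}. ?X ^ inv_between K (insert x S - K))"
      unfolding 0 by (simp only:)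
    also have "\<dots> = 1" by (simp add: inv_between_def)
    finally have "?G (insert x S) k = 1" .
    then show ?thesis by (simp add: 0)
  next
    case (Suc j)
    have j: "j \<le> card S" using insert.prems Suc cS by simp
    let ?s = "card S"
    have G: "?G (insert x S) k = ?X ^ k * ?G S k + ?G S j"
      unfolding split A using B[of j] Suc by simp
    have IHj: "?G S j * qfact j * qfact (?s - j) = (qfact ?s :: 'b fps)" using insert.IH j by blast
    have 1: "?G S j * qfact k * qfact (?s - j) = (qfact ?s :: 'b fps) * (1 - ?X ^ k)"
      unfolding IHj[symmetric] by (simp only: Suc qfact_Suc mult_ac)
    have 2: "?G S k * qfact k * qfact (?s - j) = (qfact ?s :: 'b fps) * (1 - ?X ^ (?s - j))"
    \<comment> \<open>For \<open>j = ?s\<close> both sides vanish: \<open>S\<close> has no subset of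
      size \<open>k\<close>, and the factor on the right is \<open>1 - ?X ^ 0\<close>.\<close>
    proof (cases "j = ?s")
      case True
      then show ?thesis using zero Suc by simp
    next
      case False
      then have "k \<le> ?s" and e: "?s - j = Suc (?s - k)" using j Suc by auto
      then have IHk: "?G S k * qfact k * qfact (?s - k) = (qfact ?s :: 'b fps)" using insert.IH by blast
      show ?thesis unfolding IHk[symmetric] e qfact_Suc by (simp only: mult_ac)
    qed
    have "k + (?s - j) = Suc ?s" using j Suc by simp
    then have "?X ^ k * ?X ^ (?s - j) = ?X ^ Suc ?s" by (metis power_add)
    have "?G (insert x S) k * qfact k * qfact (card (insert x S) - k) =
      ?X ^ k * (?G S k * qfact k * qfact (?s - j)) + ?G S j * qfact k * qfact (?s - j)"
      unfolding G cS by (simp add: Suc algebra_simps)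
    also have "\<dots> = qfact ?s * (?X ^ k * (1 - ?X ^ (?s - j)) + (1 - ?X ^ k))"
      unfolding 1 2 by (simp add: algebra_simps)
    also have "?X ^ k * (1 - ?X ^ (?s - j)) + (1 - ?X ^ k) = 1 - ?X ^ Suc ?s"
      unfolding \<open>?X ^ k * ?X ^ (?s - j) = ?X ^ Suc ?s\<close>[symmetric] by (simp add: algebra_simps)
    finally show ?thesis unfolding cS qfact_Suc .
  qed
qed

text \<open>The word is cut at its least letter, with \<open>K\<close> the set of letters to its
  left. For fixed size of \<open>K\<close> the weights \<open>inv_between\<close> sum to a
  q-binomial coefficient, which combines with the \<open>qfact\<close> factors of the two parts to a
  common \<open>qfact n\<close>. What remains is the right-hand side of
  \<open>banner_gf_rec\<close>.\<close>

lemma ai_des_gf: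
  assumes "finite S"
  shows "(\<Sum>w\<in>permutations_of_set S. fps_const (t ^ list_des w) * fps_X ^ list_ai w) =
    (banner_gf t (card S) * qfact (card S) :: 'b::comm_ring_1 fps)"
  using assms
proof (induction "card S" arbitrary: S rule: less_induct)
  case less
  show ?case
  proof (cases "S = {}")
    case True
    then show ?thesis by (simp add: list_des_def list_ai_def banners_0)
  next
    case False
    define x where "x = Min S"
    define S' where "S' = S - {x}"
    define n where "n = card S'"
    let ?A = "\<lambda>k. banner_gf t k * qfact k :: 'b fps"
    let ?F = "\<lambda>w. fps_const (t ^ list_des w) * fps_X ^ list_ai w :: 'b fps"
    \<comment> \<open>The power of \<open>fps_X\<close> counts the admissible inversions ending in
      the least letter, absent if nothing follows it; the factor \<open>t\<close> is the descent
      into it, absent if nothing precedes it.\<close>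
    let ?c = "\<lambda>k. (if k = n then 1 else fps_X ^ k) * (if k = 0 then 1 else fps_const t) :: 'b fps"
    have xS: "x \<in> S" using False less.prems by (simp add: x_def)
    have S: "S = insert x S'" "x \<notin> S'" "finite S'" using xS less.prems by (auto simp: S'_def)
    have cS: "card S = Suc n" using S by (simp add: n_def)
    have min: "x < y" if "y \<in> S'" for y
      using that less.prems S by (metis Min_le insertCI order.not_eq_order_implies_strict x_def)
    have split_term: "(\<Sum>L\<in>permutations_of_set K. \<Sum>R\<in>permutations_of_set (S' - K). ?F (L @ x # R)) =
      fps_X ^ inv_between K (S' - K) * ?c (card K) * ?A (card K) * ?A (n - card K)" if K: "K \<subseteq> S'" for K
    proof -
      have fK: "finite K" "finite (S' - K)" using K S(3) by (auto intro: finite_subset)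
      have cK: "card K \<le> n" "card (S' - K) = n - card K"
        using K S(3) by (auto simp: n_def card_mono card_Diff_subset fK)
      have Kn: "card K = n \<longleftrightarrow> S' - K = {}"
        using K S(3) unfolding n_def by (metis Diff_eq_empty_iff card_subset_eq subset_antisym)
      have K0: "card K = 0 \<longleftrightarrow> K = {}" using fK by simp
      have F: "?F (L @ x # R) = fps_X ^ inv_between K (S' - K) * ?c (card K) * ?F L * ?F R"
        if L: "L \<in> permutations_of_set K" and R: "R \<in> permutations_of_set (S' - K)" for L R
      proof -
        have L': "set L = K" "distinct L" and R': "set R = S' - K" "distinct R"
          using L R by (auto simp: permutations_of_set_def)
        have d: "distinct (L @ x # R)" using L' R' S K by auto
        have m: "\<forall>y\<in>set L \<union> set R. x < y" using L' R' min K by auto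
        have len: "length L = card K" using L' by (metis distinct_card)
        have "R = [] \<longleftrightarrow> card K = n" using Kn R' by (metis set_empty)
        moreover have "L \<noteq> [] \<longleftrightarrow> card K \<noteq> 0" using len by (metis length_0_conv)
        ultimately show ?thesis
          unfolding list_ai_split[OF d m] list_des_split[OF m] L'(1) R'(1) len
          by (simp add: power_add mult_ac fps_const_mult[symmetric] del: fps_const_mult)
      qed
      have dist: "(\<Sum>L\<in>A. \<Sum>R\<in>B. c * f L * g R) = c * sum f A * sum g B"
        for c and f g :: "nat list \<Rightarrow> 'b fps" and A B
        unfolding mult.assoc unfolding sum_product unfolding sum_distrib_left ..
      have "(\<Sum>L\<in>permutations_of_set K. \<Sum>R\<in>permutations_of_set (S' - K). ?F (L @ x # R)) =
        (\<Sum>L\<in>permutations_of_set K. \<Sum>R\<in>permutations_of_set (S' - K).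
          fps_X ^ inv_between K (S' - K) * ?c (card K) * ?F L * ?F R)"
        by (intro sum.cong refl F)
      also have "\<dots> = fps_X ^ inv_between K (S' - K) * ?c (card K) *
        (\<Sum>L\<in>permutations_of_set K. ?F L) * (\<Sum>R\<in>permutations_of_set (S' - K). ?F R)"
        by (rule dist)
      also have "(\<Sum>L\<in>permutations_of_set K. ?F L) = ?A (card K)"
        by (rule less.hyps) (use cK cS fK in auto)
      also have "(\<Sum>R\<in>permutations_of_set (S' - K). ?F R) = ?A (card (S' - K))"
        by (rule less.hyps) (use cK cS fK in auto)
      finally show ?thesis unfolding cK(2) .
    qed
    have "(\<Sum>w\<in>permutations_of_set S. ?F w) =
      (\<Sum>K\<in>Pow S'. fps_X ^ inv_between K (S' - K) * ?c (card K) * ?A (card K) * ?A (n - card K))"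
      unfolding S(1) sum_permutations_of_set_split[OF S(3,2)] by (intro sum.cong refl split_term) auto
    also have "\<dots> = (\<Sum>k\<le>n. \<Sum>K | K \<in> Pow S' \<and> card K = k.
      fps_X ^ inv_between K (S' - K) * ?c (card K) * ?A (card K) * ?A (n - card K))"
      by (rule sum.group[symmetric]) (use S(3) in \<open>auto simp: n_def card_mono\<close>)
    also have "\<dots> = (\<Sum>k\<le>n. qfact n * (?c k * banner_gf t k * banner_gf t (n - k)))"
    proof (rule sum.cong[OF refl])
      fix k assume "k \<in> {..n}"
      then have k: "k \<le> card S'" by (simp add: n_def)
      have "(\<Sum>K | K \<in> Pow S' \<and> card K = k.
          fps_X ^ inv_between K (S' - K) * ?c (card K) * ?A (card K) * ?A (n - card K)) =
        (\<Sum>K | K \<subseteq> S' \<and> card K = k. fps_X ^ inv_between K (S' - K) * (?c k * ?A k * ?A (n - k)))"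
        by (rule sum.cong) (auto simp: mult.assoc)
      also have "\<dots> = ((\<Sum>K | K \<subseteq> S' \<and> card K = k. fps_X ^ inv_between K (S' - K)) * qfact k * qfact (card S' - k)) *
        (?c k * banner_gf t k * banner_gf t (n - k))"
        unfolding sum_distrib_right[symmetric] n_def[symmetric] by (simp only: mult_ac)
      also have "\<dots> = qfact n * (?c k * banner_gf t k * banner_gf t (n - k))"
        unfolding sum_inv_between[OF S(3) k] n_def ..
      finally show "(\<Sum>K | K \<in> Pow S' \<and> card K = k.
          fps_X ^ inv_between K (S' - K) * ?c (card K) * ?A (card K) * ?A (n - card K)) =
        qfact n * (?c k * banner_gf t k * banner_gf t (n - k))" .
    qed
    also have "\<dots> = qfact n * (\<Sum>k\<le>n. ?c k * banner_gf t k * banner_gf t (n - k))"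
      by (rule sum_distrib_left[symmetric])
    also have "(\<Sum>k\<le>n. ?c k * banner_gf t k * banner_gf t (n - k)) =
      banner_gf t n + fps_const t * (\<Sum>k<n. fps_X ^ k * banner_gf t k * banner_gf t (n - k))"
    proof (cases n)
      case 0
      then show ?thesis by (simp add: banners_0)
    next
      case (Suc m)
      let ?f = "\<lambda>k. fps_X ^ k * banner_gf t k * banner_gf t (n - k)"
      \<comment> \<open>The term for \<open>k = 0\<close> carries no \<open>t\<close> and becomes
        the isolated \<open>banner_gf t n\<close>. The term for \<open>k = n\<close> carries no
        power of \<open>fps_X\<close> and takes the place of the summand 0 on the right.\<close>
      have "(\<Sum>k\<le>n. ?c k * banner_gf t k * banner_gf t (n - k)) =
        banner_gf t n + (\<Sum>k<m. ?c (Suc k) * banner_gf t (Suc k) * banner_gf t (n - Suc k)) + fps_const t * banner_gf t n"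
        unfolding Suc lessThan_Suc_atMost[symmetric]
        by (subst sum.lessThan_Suc, subst sum.lessThan_Suc_shift) (simp add: banners_0 mult_ac)
      also have "(\<Sum>k<m. ?c (Suc k) * banner_gf t (Suc k) * banner_gf t (n - Suc k)) = (\<Sum>k<m. fps_const t * ?f (Suc k))"
        by (rule sum.cong) (auto simp: Suc mult_ac)
      also have "banner_gf t n + (\<Sum>k<m. fps_const t * ?f (Suc k)) + fps_const t * banner_gf t n =
        banner_gf t n + fps_const t * (\<Sum>k<n. ?f k)"
        unfolding Suc sum.lessThan_Suc_shift by (simp add: banners_0 sum_distrib_left distrib_left add_ac)
      finally show ?thesis .
    qed
    also have "\<dots> = banner_gf t (Suc n) * (1 - fps_X ^ Suc n)" by (rule banner_gf_rec[symmetric])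
    finally show ?thesis unfolding cS qfact_Suc by (simp only: mult_ac)
  qed
qed

section \<open>From words to permutations and from series to counts\<close>

lemma bij_betw_permutes_lists:
  "bij_betw (\<lambda>\<sigma>. map \<sigma> [1..<Suc n]) {\<sigma>. \<sigma> permutes {1..n}} (permutations_of_set {1..n})"
proof -
  let ?h = "\<lambda>\<sigma>. map \<sigma> [1..<Suc n]"
  have inj: "inj_on ?h {\<sigma>. \<sigma> permutes {1..n}}"
  proof (rule inj_onI)
    fix \<sigma> \<tau> assume st: "\<sigma> \<in> {\<sigma>. \<sigma> permutes {1..n}}" "\<tau> \<in> {\<sigma>. \<sigma> permutes {1..n}}" and eq: "?h \<sigma> = ?h \<tau>"
    have "\<sigma> i = \<tau> i" if "i \<in> {1..n}" for i using eq that by (simp add: less_Suc_eq_le del: upt_Suc)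
    moreover have "\<sigma> i = \<tau> i" if "i \<notin> {1..n}" for i
      using st that by (simp add: permutes_not_in)
    ultimately show "\<sigma> = \<tau>" by blast
  qed
  have sub: "?h ` {\<sigma>. \<sigma> permutes {1..n}} \<subseteq> permutations_of_set {1..n}"
  proof
    fix w assume "w \<in> ?h ` {\<sigma>. \<sigma> permutes {1..n}}"
    then obtain \<sigma> where s: "\<sigma> permutes {1..n}" "w = ?h \<sigma>" by blast
    have "set w = \<sigma> ` {1..n}" using s(2) by (simp only: set_map set_upt atLeastLessThanSuc_atLeastAtMost)
    moreover have "distinct w" using s by (simp add: distinct_map permutes_inj_on del: upt_Suc)
    ultimately show "w \<in> permutations_of_set {1..n}"
      using permutes_image[OF s(1)] by (simp only: permutations_of_setI)
  qed
  have "card (?h ` {\<sigma>. \<sigma> permutes {1..n}}) = card (permutations_of_set {1..n})"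
    unfolding card_image[OF inj] by (simp add: card_permutations[OF refl])
  then have "?h ` {\<sigma>. \<sigma> permutes {1..n}} = permutations_of_set {1..n}"
    by (intro card_subset_eq sub) auto
  then show ?thesis using inj by (simp add: bij_betw_def)
qed

lemma nth_map_upt_1: "i < n \<Longrightarrow> map \<sigma> [1..<Suc n] ! i = \<sigma> (Suc i)"
  by (simp del: upt_Suc)

lemma des_eq_list_des: "des n \<sigma> = list_des (map \<sigma> [1..<Suc n])"
proof -
  have "list_des (map \<sigma> [1..<Suc n]) = (\<Sum>i<n - 1. of_bool (\<sigma> (Suc (Suc i)) < \<sigma> (Suc i)))"
    unfolding list_des_def by (rule sum.cong) (auto simp: nth_map_upt_1 simp del: upt_Suc)
  also have "\<dots> = card {i \<in> {..<n - 1}. \<sigma> (Suc (Suc i)) < \<sigma> (Suc i)}"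
    by (simp add: Int_def)
  also have "\<dots> = card (Suc ` {i \<in> {..<n - 1}. \<sigma> (Suc (Suc i)) < \<sigma> (Suc i)})"
    by (simp add: card_image)
  also have "Suc ` {i \<in> {..<n - 1}. \<sigma> (Suc (Suc i)) < \<sigma> (Suc i)} = DES n \<sigma>"
  proof (intro equalityI subsetI)
    fix i assume "i \<in> DES n \<sigma>"
    then show "i \<in> Suc ` {i \<in> {..<n - 1}. \<sigma> (Suc (Suc i)) < \<sigma> (Suc i)}"
      by (intro image_eqI[where x = "i - 1"]) (auto simp: DES_def)
  qed (auto simp: DES_def)
  finally show ?thesis by (simp add: des_def)
qed

text \<open>Pairs of letters may be counted as pairs of positions because \<open>\<sigma>\<close> is
  injective; positions shift by one.\<close>

lemma ai_eq_list_ai: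
  assumes "\<sigma> permutes {1..n}"
  shows "ai n \<sigma> = list_ai (map \<sigma> [1..<Suc n])"
proof -
  let ?w = "map \<sigma> [1..<Suc n]"
  let ?S = "Sigma {..<n} (\<lambda>j. {i \<in> {..<j}. adm ?w i j})"
  have adm: "adm ?w i j \<longleftrightarrow> \<sigma> (Suc j) < \<sigma> (Suc i) \<and> ((Suc j < n \<and> \<sigma> (Suc j) < \<sigma> (Suc j + 1)) \<or>
      (\<exists>k. Suc i < k \<and> k < Suc j \<and> \<sigma> k < \<sigma> (Suc j)))" if ij: "i < j" "j < n" for i j
  proof -
    have "(\<exists>k. i < k \<and> k < j \<and> ?w ! k < ?w ! j) \<longleftrightarrow> (\<exists>k. Suc i < k \<and> k < Suc j \<and> \<sigma> k < \<sigma> (Suc j))"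
      (is "?P \<longleftrightarrow> ?Q")
    proof
      assume ?P
      then obtain k where k: "i < k" "k < j" "?w ! k < ?w ! j" by blast
      then show ?Q using ij nth_map_upt_1[of k n \<sigma>] nth_map_upt_1[of j n \<sigma>] by (intro exI[of _ "Suc k"]) simp
    next
      assume ?Q
      then obtain k where k: "Suc i < k" "k < Suc j" "\<sigma> k < \<sigma> (Suc j)" by blast
      define k' where "k' = k - 1"
      have "k = Suc k'" using k by (simp add: k'_def)
      then show ?P using k ij nth_map_upt_1[of k' n \<sigma>] nth_map_upt_1[of j n \<sigma>] by (intro exI[of _ k']) simp
    qed
    moreover have "Suc j < length ?w \<and> ?w ! j < ?w ! Suc j \<longleftrightarrow> Suc j < n \<and> \<sigma> (Suc j) < \<sigma> (Suc j + 1)"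
      using nth_map_upt_1[of j n \<sigma>] nth_map_upt_1[of "Suc j" n \<sigma>] ij by (auto simp del: upt_Suc)
    ultimately show ?thesis
      unfolding adm_def using nth_map_upt_1[of i n \<sigma>] nth_map_upt_1[of j n \<sigma>] ij by (simp del: upt_Suc)
  qed
  have "list_ai ?w = (\<Sum>j<n. card {i \<in> {..<j}. adm ?w i j})"
    unfolding list_ai_def by (rule sum.cong) (auto simp: Int_def simp del: upt_Suc)
  also have "\<dots> = card ?S" by (rule card_SigmaI[symmetric]) auto
  also have "\<dots> = card ((\<lambda>(j, i). (\<sigma> (Suc i), \<sigma> (Suc j))) ` ?S)"
    using permutes_inj[OF assms] by (intro card_image[symmetric] inj_onI) (auto dest: injD)
  also have "(\<lambda>(j, i). (\<sigma> (Suc i), \<sigma> (Suc j))) ` ?S = admissible_inversions n \<sigma>" (is "?L = ?R")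
  proof (intro equalityI subsetI)
    fix p assume "p \<in> ?L"
    then obtain i j where p: "p = (\<sigma> (Suc i), \<sigma> (Suc j))" "i < j" "j < n" "adm ?w i j"
      by (auto simp del: upt_Suc)
    have "1 \<le> Suc i \<and> Suc i < Suc j \<and> Suc j \<le> n \<and> \<sigma> (Suc i) > \<sigma> (Suc j) \<and>
        ((Suc j < n \<and> \<sigma> (Suc j) < \<sigma> (Suc j + 1)) \<or> (\<exists>k. Suc i < k \<and> k < Suc j \<and> \<sigma> k < \<sigma> (Suc j)))"
      using adm[OF p(2,3)] p by simp
    then show "p \<in> ?R" unfolding admissible_inversions_def p(1) by blast
  next
    fix p assume "p \<in> ?R"
    then obtain i j where p: "p = (\<sigma> i, \<sigma> j)" "1 \<le> i" "i < j" "j \<le> n" "\<sigma> i > \<sigma> j"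
      "(j < n \<and> \<sigma> j < \<sigma> (j + 1)) \<or> (\<exists>k. i < k \<and> k < j \<and> \<sigma> k < \<sigma> j)"
      unfolding admissible_inversions_def by blast
    obtain i' j' where ij: "i = Suc i'" "j = Suc j'" using p by (metis Suc_le_D le_trans less_imp_le One_nat_def)
    have "adm ?w i' j'" using adm[of i' j'] p ij by simp
    then have "(j', i') \<in> ?S" using p ij by simp
    then show "p \<in> ?L" by (rule rev_image_eqI) (simp add: p ij)
  qed
  finally show ?thesis by (simp add: ai_def)
qed

lemma ai_des_eq_dex_exc:
  "(\<Sum>\<sigma> | \<sigma> permutes {1..n}. fps_const (t ^ des n \<sigma>) * fps_X ^ ai n \<sigma>) =
   (\<Sum>\<sigma> | \<sigma> permutes {1..n}. fps_const (t ^ exc n \<sigma>) * fps_X ^ (\<Sum> (dex n \<sigma>)) :: 'b::comm_ring_1 fps)"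
proof -
  have "(\<Sum>\<sigma> | \<sigma> permutes {1..n}. fps_const (t ^ des n \<sigma>) * fps_X ^ ai n \<sigma> :: 'b fps) =
    (\<Sum>\<sigma> | \<sigma> permutes {1..n}. fps_const (t ^ list_des (map \<sigma> [1..<Suc n])) * fps_X ^ list_ai (map \<sigma> [1..<Suc n]))"
    by (rule sum.cong) (simp_all add: ai_eq_list_ai des_eq_list_des del: upt_Suc)
  also have "\<dots> = (\<Sum>w\<in>permutations_of_set {1..n}. fps_const (t ^ list_des w) * fps_X ^ list_ai w)"
    by (rule sum.reindex_bij_betw[OF bij_betw_permutes_lists])
  also have "\<dots> = banner_gf t n * qfact n" using ai_des_gf[of "{1..n}" t] by simp
  finally show ?thesis by (simp only: dex_exc_gf)
qed

text \<open>With a polynomial variable for \<open>t\<close>, the coefficient at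
  \<open>(i, j)\<close> is the number of \<open>x\<close> with this pair of statistics. Equal series
  thus mean equal multisets of pairs, and a sum of \<open>F\<close> over them can be formed in any
  commutative monoid, so no subtraction is asked of the final semiring.\<close>

lemma sum_eq_if_gf_eq:
  fixes F :: "nat \<times> nat \<Rightarrow> 'c::comm_monoid_add"
  assumes "finite A"
    and eq: "(\<Sum>x\<in>A. fps_const (monom (1::int) 1 ^ b x) * fps_X ^ a x) =
      (\<Sum>x\<in>A. fps_const (monom (1::int) 1 ^ b' x) * fps_X ^ a' x)"
  shows "(\<Sum>x\<in>A. F (a x, b x)) = (\<Sum>x\<in>A. F (a' x, b' x))"
proof -
  have cnt: "Polynomial.coeff (fps_nth (\<Sum>x\<in>A. fps_const (monom (1::int) 1 ^ b x) * fps_X ^ a x) i) j =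
    int (count (image_mset (\<lambda>x. (a x, b x)) (mset_set A)) (i, j))" for a b i j
  proof -
    have "Polynomial.coeff (fps_nth (fps_const (monom (1::int) 1 ^ b x) * fps_X ^ a x) i) j =
      of_bool ((a x, b x) = (i, j))" for x
      by (simp add: monom_power fps_X_power_nth)
    then have "Polynomial.coeff (fps_nth (\<Sum>x\<in>A. fps_const (monom (1::int) 1 ^ b x) * fps_X ^ a x) i) j =
      (\<Sum>x\<in>A. of_bool ((a x, b x) = (i, j)))"
      by (simp only: fps_sum_nth coeff_sum)
    also have "\<dots> = int (card {x \<in> A. (a x, b x) = (i, j)})"
      using assms(1) by (simp add: Int_def)
    finally show ?thesis by (simp only: count_image_mset_set[OF assms(1)])
  qed
  have "image_mset (\<lambda>x. (a x, b x)) (mset_set A) = image_mset (\<lambda>x. (a' x, b' x)) (mset_set A)"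
  proof (rule multiset_eqI)
    fix p :: "nat \<times> nat"
    obtain i j where p: "p = (i, j)" by fastforce
    show "count (image_mset (\<lambda>x. (a x, b x)) (mset_set A)) p =
      count (image_mset (\<lambda>x. (a' x, b' x)) (mset_set A)) p"
      using cnt[of b a i j] cnt[of b' a' i j] eq unfolding p by (metis of_nat_eq_iff)
  qed
  then have "image_mset F (image_mset (\<lambda>x. (a x, b x)) (mset_set A)) =
    image_mset F (image_mset (\<lambda>x. (a' x, b' x)) (mset_set A))" by (simp only:)
  then show ?thesis by (simp add: sum_unfold_sum_mset image_mset.compositionality comp_def)
qed

theorem theorem4p1:
  fixes n :: nat and q t :: "'a::comm_semiring_1"
  assumes "n \<ge> 1"
  shows "(\<Sum>\<sigma> | \<sigma> permutes {1..n}. q ^ aid n \<sigma> * t ^ des n \<sigma>) =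
         (\<Sum>\<sigma> | \<sigma> permutes {1..n}. q ^ maj n \<sigma> * t ^ exc n \<sigma>)"
proof -
  let ?F = "\<lambda>(a, b). q ^ (a + b) * t ^ b"
  have "(\<Sum>\<sigma> | \<sigma> permutes {1..n}. q ^ aid n \<sigma> * t ^ des n \<sigma>) =
    (\<Sum>\<sigma> | \<sigma> permutes {1..n}. ?F (ai n \<sigma>, des n \<sigma>))" by (simp add: aid_def)
  also have "\<dots> = (\<Sum>\<sigma> | \<sigma> permutes {1..n}. ?F (\<Sum> (dex n \<sigma>), exc n \<sigma>))"
    by (rule sum_eq_if_gf_eq[OF finite_permutations[OF finite_atLeastAtMost] ai_des_eq_dex_exc])
  also have "\<dots> = (\<Sum>\<sigma> | \<sigma> permutes {1..n}. q ^ maj n \<sigma> * t ^ exc n \<sigma>)"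
    by (rule sum.cong) (simp_all add: maj_eq_dex)
  finally show ?thesis .
qed

end
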